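(* There is an absolute constant $A>0$ such that, for every real $C>0$ and every real $\rho$ with $0\le\rho<1$, one can choose $\epsilon\in(0,1)$ and $n_0\in\mathbb N$ satisfying $$\epsilon\ge\exp\!\left[-A\left(1+\frac{C}{1-\rho}\right)\right],\qquad n_0\le\exp\!\left[A\left(1+\frac{C}{1-\rho}\right)\right],$$ such that, for every integer $n\ge n_0$ and every $x=(x_1,\dots,x_n)\in[-1,1]^n$, there exists $y\in\{-1,1\}^n$ with $$E_\rho(P;x,y)>\epsilon n\qquad\text{for every }P\in\mathcal P_{(1+\epsilon)n}(C).$$
   Context: $\mathbb N=\{1,2,\ldots\}$. For a polynomial $P$ put $\|P\|_{[-1,1]}=\max_{-1\le t\le1}|P(t)|$. Node vectors $x\in[-1,1]^n$ may have repeated entries; counts always refer to indices. For $x,y\in[-1,1]^n$ and $\rho\ge0$, $$E_\rho(P;x,y):=\#\{i\in\{1,\dots,n\}:|P(x_i)-y_i|>\rho\}.$$ For real $D\ge0$ and $C>0$, $$\mathcal P_D(C):=\{P\in\mathbb C[X]:\deg P\le D,\ \|P\|_{[-1,1]}\le C\},$$ with $\deg 0=-\infty$ (so the zero polynomial belongs to every class); $D$ need not be an integer. A constant is called absolute if it is independent of all nodes and all displayed parameters. *)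

theory Defs
  imports "HOL-Analysis.Analysis" "HOL-Computational_Algebra.Polynomial"
begin

text \<open>
  Vectors in \<open>\<real>\<^sup>n\<close> are functions \<open>nat \<Rightarrow> real\<close> of which only the values at the
  indices \<open>1, \<dots>, n\<close> matter.
\<close>

text \<open>
  Since \<open>Max\<close> is reserved for finite sets, the norm is written as a supremum; it is
  attained, as the lemma below shows.
\<close>

definition unit_norm :: "complex poly \<Rightarrow> real" where
  "unit_norm P = (SUP t\<in>{-1..1::real}. cmod (poly P (of_real t)))"

lemma unit_norm_is_max:
  "\<exists>t\<in>{-1..1::real}. unit_norm P = cmod (poly P (of_real t)) \<and>
     (\<forall>s\<in>{-1..1}. cmod (poly P (of_real s)) \<le> cmod (poly P (of_real t)))"
proof -
  have "continuous_on {-1..1::real} (\<lambda>t. cmod (poly P (of_real t)))"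
    by (intro continuous_intros)
  then obtain t where t: "t \<in> {-1..1::real}"
    and max: "\<forall>s\<in>{-1..1}. cmod (poly P (of_real s)) \<le> cmod (poly P (of_real t))"
    using continuous_attains_sup[of "{-1..1::real}" "\<lambda>t. cmod (poly P (of_real t))"] by auto
  have "unit_norm P = cmod (poly P (of_real t))"
    unfolding unit_norm_def by (rule cSup_eq_maximum) (use t max in auto)
  with t max show ?thesis by blast
qed

definition error_count ::
    "real \<Rightarrow> nat \<Rightarrow> complex poly \<Rightarrow> (nat \<Rightarrow> real) \<Rightarrow> (nat \<Rightarrow> real) \<Rightarrow> nat" where
  "error_count \<rho> n P x y =
     card {i \<in> {1..n}. cmod (poly P (of_real (x i)) - of_real (y i)) > \<rho>}"

text \<open>
  The disjunct \<open>P = 0\<close> encodes the convention that the zero polynomial has degree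
  minus infinity, whereas \<open>degree 0 = 0\<close> in the library.
\<close>

definition poly_class :: "real \<Rightarrow> real \<Rightarrow> complex poly set" where
  "poly_class D C = {P. (P = 0 \<or> real (degree P) \<le> D) \<and> unit_norm P \<le> C}"

end

theory Submission
  imports Defs
begin

text \<open>
  Only \<open>y\<^sub>i Re P(x\<^sub>i) \<ge> 1 - \<rho>\<close> is used, so put \<open>K = C / (1 - \<rho>)\<close>.  Call a set of at most \<open>2W\<close>
  indices bad if some sign pattern on it is not realized by the class.  If there are more than
  \<open>\<epsilon>n\<close> disjoint bad sets, gluing their patterns gives \<open>y\<close>.  Otherwise all but few indices survive
  the removal of a maximal disjoint family of bad sets, every small set of survivors is shattered,
  and Bernstein's inequality separates the surviving nodes by a multiple of \<open>1 / (nK)\<close> in the angle.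

  Let \<open>m \<approx> (1 + \<epsilon>)n\<close>, \<open>q \<approx> n / R\<close>, and complete the survivors by \<open>O(q)\<close> nearly Fekete points \<open>Z\<close> to
  \<open>m + q + 1\<close> interpolation nodes, so that the fundamental polynomials of \<open>Z\<close> are bounded by 2.
  Averaging Lagrange interpolation over translations of the function \<open>h(s)\<close>, a Fejer kernel \<open>J\<close> of
  degree \<open>q\<close> times \<open>2 sin((m+q)s) \<Sum>\<^sub>k sin(ks)/k\<close>, produces the Fourier partial sum of \<open>h\<close> at 0, which is
  at least \<open>ln R\<close>, although \<open>h = O(J)\<close>.  Conversely, realizing the signs of the fundamental
  polynomials near a point and multiplying by a translate of \<open>J\<close> bounds the same average by a
  multiple of \<open>1 + K\<close>.  Hence \<open>ln R\<close> is bounded by a multiple of \<open>1 + K\<close>.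
\<close>

section \<open>Trigonometric averages and Bernstein's inequality\<close>

text \<open>
  On trigonometric polynomials of degree less than \<open>M\<close> this is the mean over a period, so no
  integration is needed.
\<close>

definition avg :: "nat \<Rightarrow> (real \<Rightarrow> real) \<Rightarrow> real" where
  "avg M f = (\<Sum>k<M. f (2 * pi * real k / real M)) / real M"

lemma avg_add: "avg M (\<lambda>t. f t + g t) = avg M f + avg M g"
  by (simp add: avg_def sum.distrib add_divide_distrib)

lemma avg_diff: "avg M (\<lambda>t. f t - g t) = avg M f - avg M g"
  by (simp add: avg_def sum_subtractf diff_divide_distrib)

lemma avg_cmult: "avg M (\<lambda>t. c * f t) = c * avg M f"
  by (simp add: avg_def sum_distrib_left)

lemma avg_sum: "avg M (\<lambda>t. \<Sum>i\<in>I. f i t) = (\<Sum>i\<in>I. avg M (f i))"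
  unfolding avg_def by (subst sum.swap) (simp add: sum_divide_distrib)

lemma avg_const: "0 < M \<Longrightarrow> avg M (\<lambda>t. c) = c"
  by (simp add: avg_def)

lemma avg_mono: "(\<And>t. f t \<le> g t) \<Longrightarrow> avg M f \<le> avg M g"
  unfolding avg_def by (intro divide_right_mono sum_mono) auto

lemma abs_avg_le: "\<bar>avg M f\<bar> \<le> avg M (\<lambda>t. \<bar>f t\<bar>)"
  unfolding avg_def by (simp add: divide_right_mono)

text \<open>The samples form a geometric progression in the root of unity \<open>cis a\<close>,
  which equals 1 only if \<open>M\<close> divides \<open>z\<close>; the bound on \<open>z\<close>
  thus excludes aliasing. The phase \<open>\<phi>\<close> lets sines and shifted cosines share this
  one rule.\<close>

lemma avg_cos:
  fixes z :: int
  assumes "\<bar>z\<bar> < int M"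
  shows "avg M (\<lambda>t. cos (of_int z * t + \<phi>)) = (if z = 0 then cos \<phi> else 0)"
proof (cases "z = 0")
  case True
  then show ?thesis using assms by (simp add: avg_const)
next
  case False
  define a where "a = 2 * pi * of_int z / real M"
  have M: "M > 0" using assms by linarith
  have "cis a \<noteq> 1"
  proof
    assume "cis a = 1"
    then have "cos a = 1" by (metis cis.sel(1) one_complex.sel(1))
    then obtain k :: int where "a = of_int k * 2 * pi" using cos_one_2pi_int by metis
    then have "real_of_int z = real_of_int k * real M"
      using M by (simp add: a_def field_simps)
    then have "z = k * int M" by (metis of_int_eq_iff of_int_mult of_int_of_nat_eq)
    with assms False show False
      by (metis abs_mult abs_of_nat dvd_imp_le_int dvd_triv_right linorder_not_le)
  qed
  moreover have "cis a ^ M = 1"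
  proof -
    have "real M * a = 2 * pi * of_int z" using M by (simp add: a_def)
    then show ?thesis using cis_multiple_2pi[of "of_int z"] Complex.DeMoivre[of a M] by simp
  qed
  ultimately have "(\<Sum>k<M. cis a ^ k) = 0" by (simp add: geometric_sum)
  then have "Re (cis \<phi> * (\<Sum>k<M. cis a ^ k)) = 0" by simp
  also have "cis \<phi> * (\<Sum>k<M. cis a ^ k) = (\<Sum>k<M. cis (of_int z * (2 * pi * real k / real M) + \<phi>))"
    unfolding sum_distrib_left Complex.DeMoivre cis_mult
    by (intro sum.cong refl arg_cong[where f = cis]) (simp add: a_def field_simps)
  finally show ?thesis using False by (simp add: avg_def)
qed

section \<open>Fejer kernels and their Fourier coefficients\<close>

definition fejer :: "nat \<Rightarrow> real \<Rightarrow> real" where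
  "fejer q s = (\<Sum>a<q. \<Sum>b<q. cos ((real a - real b) * s)) / (real q)\<^sup>2"

lemma Re_cis_pow: "Re (cis s ^ a) = cos (real a * s)" and Im_cis_pow: "Im (cis s ^ a) = sin (real a * s)"
  by (simp_all add: Complex.DeMoivre)

lemma fejer_eq_norm: "fejer q s = (cmod (\<Sum>a<q. cis s ^ a))\<^sup>2 / (real q)\<^sup>2"
proof -
  have "(cmod (\<Sum>a<q. cis s ^ a))\<^sup>2 = (\<Sum>a<q. cos (real a * s))\<^sup>2 + (\<Sum>a<q. sin (real a * s))\<^sup>2"
    by (simp add: cmod_power2 Re_cis_pow Im_cis_pow)
  also have "\<dots> = (\<Sum>a<q. \<Sum>b<q. cos ((real a - real b) * s))"
    by (simp add: power2_eq_square sum_product left_diff_distrib cos_diff sum.distrib)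
  finally show ?thesis by (simp add: fejer_def)
qed

lemma fejer_nonneg: "0 \<le> fejer q s"
  by (simp add: fejer_eq_norm)

lemma fejer_le_1: "fejer q s \<le> 1"
proof -
  have "cmod (\<Sum>a<q. cis s ^ a) \<le> real q"
    using norm_sum[of "\<lambda>a. cis s ^ a" "{..<q}"] by (simp add: norm_power)
  then have "(cmod (\<Sum>a<q. cis s ^ a))\<^sup>2 \<le> (real q)\<^sup>2" by (simp add: power_mono)
  then show ?thesis by (auto simp: fejer_eq_norm divide_le_eq_1 not_less zero_less_power2)
qed

lemma fejer_0: "0 < q \<Longrightarrow> fejer q 0 = 1"
  by (simp add: fejer_def power2_eq_square)

lemma fejer_minus: "fejer q (- s) = fejer q s"
  by (simp add: fejer_def)

text \<open>In the geometric series \<open>1 - cis s\<close> has modulus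
  \<open>2 * |sin (s / 2)|\<close> and \<open>1 - cis s ^ q\<close> has modulus at most 2. The
  product form covers the zeros of the sine as well.\<close>

lemma fejer_bound: "fejer q s * (real q * sin (s / 2))\<^sup>2 \<le> 1"
proof (cases "q = 0")
  case False
  have "cmod (1 - cis s) = 2 * \<bar>sin (s / 2)\<bar>"
  proof -
    have "(cmod (1 - cis s))\<^sup>2 = (1 - cos s)\<^sup>2 + (sin s)\<^sup>2" by (simp add: cmod_power2)
    also have "\<dots> = 2 - 2 * cos s" using sin_cos_squared_add[of s] by (simp add: power2_eq_square algebra_simps)
    also have "\<dots> = (2 * \<bar>sin (s / 2)\<bar>)\<^sup>2" using cos_double_sin[of "s/2"] by (simp add: power_mult_distrib)
    finally show ?thesis by (subst (asm) power2_eq_iff_nonneg) auto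
  qed
  moreover have "(1 - cis s) * (\<Sum>a<q. cis s ^ a) = 1 - cis s ^ q"
    by (metis one_diff_power_eq)
  moreover have "cmod (1 - cis s ^ q) \<le> 2"
    using norm_triangle_ineq4[of 1 "cis s ^ q"] by (simp add: norm_power)
  ultimately have "2 * \<bar>sin (s / 2)\<bar> * cmod (\<Sum>a<q. cis s ^ a) \<le> 2"
    by (metis norm_mult)
  then have "\<bar>sin (s / 2)\<bar> * cmod (\<Sum>a<q. cis s ^ a) \<le> 1" by simp
  then have "(\<bar>sin (s / 2)\<bar> * cmod (\<Sum>a<q. cis s ^ a))\<^sup>2 \<le> 1"
    by (simp add: power_le_one)
  then show ?thesis using False by (simp add: fejer_eq_norm power_mult_distrib mult.commute)
qed auto

text \<open>Product-to-sum produces the shifts by \<open>a - b\<close> and by \<open>b - a\<close>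
  with weight one half each; exchanging the two summation indices merges them.\<close>

lemma cos_mult_fejer:
  fixes l :: int
  shows "cos (of_int l * t + \<phi>) * fejer q t =
    (\<Sum>a<q. \<Sum>b<q. cos (of_int (l + int a - int b) * t + \<phi>)) / (real q)\<^sup>2"
proof -
  have "cos (of_int l * t + \<phi>) * (\<Sum>a<q. \<Sum>b<q. cos ((real a - real b) * t)) =
    (\<Sum>a<q. \<Sum>b<q. (cos (of_int (l + int a - int b) * t + \<phi>)
      + cos (of_int (l + int b - int a) * t + \<phi>)) / 2)"
    by (simp add: sum_distrib_left cos_times_cos algebra_simps)
  also have "\<dots> = (\<Sum>a<q. \<Sum>b<q. cos (of_int (l + int a - int b) * t + \<phi>)) / 2
      + (\<Sum>a<q. \<Sum>b<q. cos (of_int (l + int b - int a) * t + \<phi>)) / 2"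
    by (simp add: sum.distrib sum_divide_distrib add_divide_distrib)
  also have "(\<Sum>a<q. \<Sum>b<q. cos (of_int (l + int b - int a) * t + \<phi>))
    = (\<Sum>a<q. \<Sum>b<q. cos (of_int (l + int a - int b) * t + \<phi>))"
    by (rule sum.swap)
  finally show ?thesis by (simp add: fejer_def)
qed

text \<open>Only the pairs with \<open>b = l + a\<close> have frequency zero, and there are
  \<open>q - l\<close> of them; truncated subtraction gives the correct value 0 for
  \<open>l \<ge> q\<close>. The condition \<open>l + q \<le> M\<close> keeps every frequency below
  \<open>M\<close> in modulus.\<close>

lemma avg_cos_mult_fejer:
  assumes "l + q \<le> M" "0 < q"
  shows "avg M (\<lambda>t. cos (real l * t + \<phi>) * fejer q t) = real (q - l) / (real q)\<^sup>2 * cos \<phi>"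
proof -
  have "avg M (\<lambda>t. cos (real l * t + \<phi>) * fejer q t)
    = avg M (\<lambda>t. (1 / (real q)\<^sup>2) * (\<Sum>a<q. \<Sum>b<q. cos (of_int (int l + int a - int b) * t + \<phi>)))"
    using cos_mult_fejer[of "int l"] by simp
  also have "\<dots> = (1 / (real q)\<^sup>2) * (\<Sum>a<q. \<Sum>b<q. avg M (\<lambda>t. cos (of_int (int l + int a - int b) * t + \<phi>)))"
    by (subst avg_cmult) (simp only: avg_sum)
  also have "(\<Sum>a<q. \<Sum>b<q. avg M (\<lambda>t. cos (of_int (int l + int a - int b) * t + \<phi>)))
     = (\<Sum>a<q. \<Sum>b<q. if b = l + a then cos \<phi> else 0)"
  proof (intro sum.cong refl)
    fix a b assume "a \<in> {..<q}" "b \<in> {..<q}"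
    then have "\<bar>int l + int a - int b\<bar> < int M" using assms by auto
    then show "avg M (\<lambda>t. cos (of_int (int l + int a - int b) * t + \<phi>)) = (if b = l + a then cos \<phi> else 0)"
      by (subst avg_cos) auto
  qed
  also have "\<dots> = (\<Sum>a<q. if a < q - l then cos \<phi> else 0)"
    by (intro sum.cong refl) (auto simp: sum.delta)
  also have "\<dots> = real (q - l) * cos \<phi>"
  proof -
    have "{..<q} \<inter> {a. a < q - l} = {..<q - l}" by auto
    then show ?thesis by (simp add: sum.If_cases)
  qed
  finally show ?thesis by simp
qed

text \<open>The kernel is normalized by its value 1 at 0 instead of by its mean, so it is the
  classical Fejer kernel divided by \<open>q\<close>.\<close>

lemma avg_fejer:
  assumes "q \<le> M" "0 < q"
  shows "avg M (fejer q) = 1 / real q"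
  using avg_cos_mult_fejer[of 0 q M 0] assms by (simp add: power2_eq_square)

lemma avg_fejer_shift:
  assumes "q \<le> M" "0 < q"
  shows "avg M (\<lambda>t. fejer q (c + t)) = 1 / real q" "avg M (\<lambda>t. fejer q (c - t)) = 1 / real q"
proof -
  have plus: "avg M (\<lambda>t. fejer q (c + t)) = 1 / real q" for c
  proof -
    have "avg M (\<lambda>t. fejer q (c + t)) =
      avg M (\<lambda>t. (1 / (real q)\<^sup>2) * (\<Sum>a<q. \<Sum>b<q. cos (of_int (int a - int b) * t + of_int (int a - int b) * c)))"
      by (simp add: fejer_def algebra_simps)
    also have "\<dots> = (1 / (real q)\<^sup>2) * (\<Sum>a<q. \<Sum>b<q. avg M (\<lambda>t. cos (of_int (int a - int b) * t + of_int (int a - int b) * c)))"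
      by (subst avg_cmult) (simp only: avg_sum)
    also have "(\<Sum>a<q. \<Sum>b<q. avg M (\<lambda>t. cos (of_int (int a - int b) * t + of_int (int a - int b) * c)))
      = (\<Sum>a<q. \<Sum>b<q. if b = a then 1 else 0)"
    proof (intro sum.cong refl)
      fix a b assume "a \<in> {..<q}" "b \<in> {..<q}"
      then have "\<bar>int a - int b\<bar> < int M" using assms by auto
      then show "avg M (\<lambda>t. cos (of_int (int a - int b) * t + of_int (int a - int b) * c)) = (if b = a then 1 else 0)"
        by (subst avg_cos) auto
    qed
    also have "\<dots> = real q" by (simp add: sum.delta)
    finally show ?thesis by (simp add: power2_eq_square)
  qed
  then show "avg M (\<lambda>t. fejer q (c + t)) = 1 / real q" .
  have "(\<lambda>t. fejer q (c - t)) = (\<lambda>t. fejer q (- c + t))"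
    using fejer_minus[of q] by (metis minus_diff_eq uminus_add_conv_diff)
  then show "avg M (\<lambda>t. fejer q (c - t)) = 1 / real q" using plus[of "- c"] by (simp only:)
qed

section \<open>Cosine expansions, Chebyshev polynomials and Bernstein's inequality\<close>

lemma poly_cos_expansion:
  fixes p :: "real poly"
  assumes "degree p \<le> m"
  shows "\<exists>c. \<forall>\<theta>. poly p (cos \<theta>) = (\<Sum>k\<le>m. c k * cos (real k * \<theta>))"
  using assms
proof (induction p arbitrary: m)
  case 0
  then show ?case by (auto intro: exI[of _ "\<lambda>_. 0"])
next
  case (pCons a p)
  show ?case
  proof (cases "p = 0")
    case True
    have "(\<Sum>k\<le>m. (if k = 0 then a else 0) * cos (real k * \<theta>)) = a" for \<theta>
    proof -
      have "(\<Sum>k\<le>m. (if k = 0 then a else 0) * cos (real k * \<theta>)) = (\<Sum>k\<le>m. if k = 0 then a else 0)"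
        by (intro sum.cong) auto
      then show ?thesis by simp
    qed
    then show ?thesis using True by (intro exI[of _ "\<lambda>k. if k = 0 then a else 0"]) simp
  next
    case False
    then obtain m' where m': "m = Suc m'" "degree p \<le> m'"
      using pCons.prems by (cases m) auto
    obtain c where c: "\<And>\<theta>. poly p (cos \<theta>) = (\<Sum>k\<le>m'. c k * cos (real k * \<theta>))"
      using pCons.IH[OF m'(2)] by blast
    \<comment> \<open>Multiplication by \<open>cos \<theta>\<close> sends half of each coefficient
      one frequency up and half one frequency down, except that \<open>c 0\<close> goes entirely to
      frequency 1; the last summand supplies its second half.\<close>
    define d where "d k = (if k = 0 then a else 0) + (if k = 0 then 0 else c (k - 1) / 2)
      + (if k < m' then c (Suc k) / 2 else 0) + (if k = 1 then c 0 / 2 else 0)" for k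
    have "poly (pCons a p) (cos \<theta>) = (\<Sum>k\<le>m. d k * cos (real k * \<theta>))" for \<theta>
    proof -
      let ?C = "\<lambda>k::nat. cos (real k * \<theta>)"
      have *: "cos \<theta> * ?C (Suc k) = (?C (Suc (Suc k)) + ?C k) / 2" for k
        by (simp add: cos_times_cos algebra_simps)
      have "cos \<theta> * (\<Sum>k\<le>m'. c k * ?C k) = c 0 * cos \<theta> + (\<Sum>k<m'. c (Suc k) * (cos \<theta> * ?C (Suc k)))"
        by (simp add: sum.atMost_shift distrib_left sum_distrib_left mult_ac)
      also have "\<dots> = c 0 / 2 * ?C 1 + (c 0 / 2 * ?C 1 + (\<Sum>k<m'. c (Suc k) / 2 * ?C (Suc (Suc k))))
           + (\<Sum>k<m'. c (Suc k) / 2 * ?C k)"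
        unfolding * by (simp add: sum.distrib add_divide_distrib distrib_left)
      also have "c 0 / 2 * ?C 1 + (\<Sum>k<m'. c (Suc k) / 2 * ?C (Suc (Suc k))) = (\<Sum>k\<le>m'. c k / 2 * ?C (Suc k))"
        by (simp add: sum.atMost_shift)
      also have "\<dots> = (\<Sum>k\<le>m. (if k = 0 then 0 else c (k - 1) / 2) * ?C k)"
        unfolding m'(1) by (subst (2) sum.atMost_shift) (simp add: lessThan_Suc_atMost)
      also have "(\<Sum>k<m'. c (Suc k) / 2 * ?C k) = (\<Sum>k\<le>m. (if k < m' then c (Suc k) / 2 else 0) * ?C k)"
        by (rule sum.mono_neutral_cong_left) (auto simp: m')
      also have "c 0 / 2 * ?C 1 = (\<Sum>k\<le>m. (if k = 1 then c 0 / 2 else 0) * ?C k)"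
        by (rule trans[OF _ sum.mono_neutral_left[of _ "{1}"]]) (auto simp: m')
      moreover have "a = (\<Sum>k\<le>m. (if k = 0 then a else 0) * ?C k)"
        by (rule trans[OF _ sum.mono_neutral_left[of _ "{0}"]]) auto
      ultimately show ?thesis
        by (simp add: c d_def distrib_right sum.distrib)
    qed
    then show ?thesis by blast
  qed
qed

fun cheb :: "nat \<Rightarrow> real poly" where
  "cheb 0 = 1"
| "cheb (Suc 0) = [:0, 1:]"
| "cheb (Suc (Suc n)) = [:0, 2:] * cheb (Suc n) - cheb n"

lemma poly_cheb_cos: "poly (cheb k) (cos \<theta>) = cos (real k * \<theta>)"
proof (induction k rule: cheb.induct)
  case (3 n)
  then show ?case
    using cos_times_cos[of \<theta> "real (Suc n) * \<theta>"] by (simp add: algebra_simps)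
qed auto

lemma degree_cheb: "degree (cheb k) \<le> k"
proof (induction k rule: cheb.induct)
  case (3 n)
  have "degree ([:0, 2:] * cheb (Suc n)) \<le> Suc (Suc n)"
    using degree_mult_le[of "[:0, 2:]" "cheb (Suc n)"] 3(1) by simp
  then show ?case using 3(2) by (auto intro: degree_diff_le)
qed auto

text \<open>Only the frequencies \<open>k - j\<close> and \<open>k + j\<close> with
  \<open>j \<le> degree p\<close> occur; they are nonzero and smaller than \<open>M\<close>.\<close>

lemma avg_cos_poly_cos:
  fixes p :: "real poly"
  assumes "degree p < k" "k + degree p < M"
  shows "avg M (\<lambda>t. cos (real k * t) * poly p (cos t)) = 0"
proof -
  obtain c where c: "\<And>\<theta>. poly p (cos \<theta>) = (\<Sum>j\<le>degree p. c j * cos (real j * \<theta>))"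
    using poly_cos_expansion[of p "degree p"] by auto
  have "cos (real k * t) * poly p (cos t) = (\<Sum>j\<le>degree p. c j / 2 * (cos (of_int (int k - int j) * t + 0)
      + cos (of_int (int k + int j) * t + 0)))" for t
  proof -
    have "cos (real k * t) * cos (real j * t) = 1 / 2 * (cos (of_int (int k - int j) * t + 0)
      + cos (of_int (int k + int j) * t + 0))" for j
      by (simp add: left_diff_distrib distrib_right cos_diff cos_add)
    then have "c j * (cos (real k * t) * cos (real j * t)) = c j * (1 / 2 * (cos (of_int (int k - int j) * t + 0)
      + cos (of_int (int k + int j) * t + 0)))" for j by (simp only:)
    then have "cos (real k * t) * (c j * cos (real j * t)) = c j / 2 * (cos (of_int (int k - int j) * t + 0)
      + cos (of_int (int k + int j) * t + 0))" for j by (simp only: mult.left_commute)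
    then show ?thesis unfolding c sum_distrib_left by (intro sum.cong refl)
  qed
  then have "avg M (\<lambda>t. cos (real k * t) * poly p (cos t)) =
    (\<Sum>j\<le>degree p. c j / 2 * (avg M (\<lambda>t. cos (of_int (int k - int j) * t + 0))
      + avg M (\<lambda>t. cos (of_int (int k + int j) * t + 0))))"
    by (simp only: avg_sum avg_cmult avg_add)
  also have "\<dots> = 0"
    proof (rule sum.neutral, rule ballI)
    fix j assume "j \<in> {..degree p}"
    then have "\<bar>int k - int j\<bar> < int M" "\<bar>int k + int j\<bar> < int M" "int k - int j \<noteq> 0" "int k + int j \<noteq> 0"
      using assms by auto
    then show "c j / 2 * (avg M (\<lambda>t. cos (of_int (int k - int j) * t + 0))
      + avg M (\<lambda>t. cos (of_int (int k + int j) * t + 0))) = 0"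
      by (simp only: avg_cos) simp
  qed
  finally show ?thesis .
qed

text \<open>Averaging \<open>F (\<theta> + t)\<close> against
  \<open>2 m^2 sin (m t) fejer m t\<close> yields the derivative of \<open>F\<close>, and this
  weight has absolute mean at most \<open>2 m\<close>. The derivative bound is then integrated to a
  Lipschitz bound in the angle.\<close>

lemma bernstein:
  fixes p :: "real poly"
  assumes deg: "degree p \<le> m" and bd: "\<And>x. x \<in> {-1..1} \<Longrightarrow> \<bar>poly p x\<bar> \<le> K"
  shows "\<bar>poly p (cos a) - poly p (cos b)\<bar> \<le> 2 * real m * K * \<bar>a - b\<bar>"
proof (cases "m = 0")
  case True
  then obtain c where "p = [:c:]" using deg by (meson degree_eq_zeroE le_zero_eq)
  then show ?thesis using True by simp
next
  case False
  obtain c where c: "\<And>\<theta>. poly p (cos \<theta>) = (\<Sum>k\<le>m. c k * cos (real k * \<theta>))"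
    using poly_cos_expansion[OF deg] by auto
  define F where "F \<theta> = (\<Sum>k\<le>m. c k * cos (real k * \<theta>))" for \<theta>
  define F' where "F' \<theta> = (\<Sum>k\<le>m. c k * (- real k * sin (real k * \<theta>)))" for \<theta>
  define M where "M = 4 * m"
  have F: "F \<theta> = poly p (cos \<theta>)" for \<theta> by (simp add: F_def c)
  have absF: "\<bar>F \<theta>\<bar> \<le> K" for \<theta> unfolding F by (rule bd) simp
  have deriv: "(F has_real_derivative F' \<theta>) (at \<theta>)" for \<theta>
    unfolding F_def F'_def by (auto intro!: derivative_eq_intros sum.cong)
  \<comment> \<open>The frequency \<open>k\<close> coefficient of \<open>sin(mt) fejer m t\<close> is proportional to \<open>k\<close> for \<open>|k| \<le> m\<close>.\<close>
  have repr: "F' \<theta> = (2 * (real m)\<^sup>2) * avg M (\<lambda>t. F (\<theta> + t) * sin (real m * t) * fejer m t)" for \<theta>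
  proof -
    have "avg M (\<lambda>t. F (\<theta> + t) * sin (real m * t) * fejer m t) =
      (\<Sum>k\<le>m. c k * avg M (\<lambda>t. cos (real k * (\<theta> + t)) * sin (real m * t) * fejer m t))"
      unfolding F_def sum_distrib_right by (simp only: avg_sum avg_cmult mult.assoc)
    also have "\<dots> = (\<Sum>k\<le>m. c k * (- real k * sin (real k * \<theta>) / (2 * (real m)\<^sup>2)))"
    proof (intro sum.cong refl arg_cong[where f = "\<lambda>x. c _ * x"])
      fix k assume "k \<in> {..m}"
      then have k: "k \<le> m" by simp
      have "cos (real k * (\<theta> + t)) * sin (real m * t) = 1/2 * (cos (real (m + k) * t + (real k * \<theta> - pi / 2))
         + cos (real (m - k) * t + (- (real k * \<theta>) - pi / 2)))" for t
      proof -
        have "sin (real m * t) = cos (real m * t - pi / 2)" by (simp add: cos_diff)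
        moreover have "cos (real (m - k) * t + (- (real k * \<theta>) - pi / 2)) = cos (real k * (\<theta> + t) - (real m * t - pi / 2))"
          using k by (subst cos_minus[symmetric]) (simp add: of_nat_diff algebra_simps)
        ultimately show ?thesis by (simp add: cos_times_cos algebra_simps)
      qed
      then have "avg M (\<lambda>t. cos (real k * (\<theta> + t)) * sin (real m * t) * fejer m t) =
        avg M (\<lambda>t. 1/2 * (cos (real (m + k) * t + (real k * \<theta> - pi / 2)) * fejer m t
         + cos (real (m - k) * t + (- (real k * \<theta>) - pi / 2)) * fejer m t))"
        by (simp add: algebra_simps)
      also have "\<dots> = 1/2 * (avg M (\<lambda>t. cos (real (m + k) * t + (real k * \<theta> - pi / 2)) * fejer m t)
         + avg M (\<lambda>t. cos (real (m - k) * t + (- (real k * \<theta>) - pi / 2)) * fejer m t))"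
        by (simp only: avg_cmult avg_add)
      also have "avg M (\<lambda>t. cos (real (m + k) * t + (real k * \<theta> - pi / 2)) * fejer m t) = 0"
        using k False by (subst avg_cos_mult_fejer) (auto simp: M_def)
      also have "avg M (\<lambda>t. cos (real (m - k) * t + (- (real k * \<theta>) - pi / 2)) * fejer m t)
          = real (m - (m - k)) / (real m)\<^sup>2 * cos (- (real k * \<theta>) - pi / 2)"
        using k False by (subst avg_cos_mult_fejer) (auto simp: M_def)
      also have "cos (- (real k * \<theta>) - pi / 2) = - sin (real k * \<theta>)" by (simp add: cos_diff)
      finally show "avg M (\<lambda>t. cos (real k * (\<theta> + t)) * sin (real m * t) * fejer m t)
        = - real k * sin (real k * \<theta>) / (2 * (real m)\<^sup>2)"
        using k by simp
    qed
    also have "\<dots> = F' \<theta> / (2 * (real m)\<^sup>2)"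
      unfolding F'_def by (simp add: sum_divide_distrib)
    finally show ?thesis using False by (simp add: power2_eq_square)
  qed
  have absF': "\<bar>F' \<theta>\<bar> \<le> 2 * real m * K" for \<theta>
  proof -
    have "\<bar>avg M (\<lambda>t. F (\<theta> + t) * sin (real m * t) * fejer m t)\<bar>
        \<le> avg M (\<lambda>t. \<bar>F (\<theta> + t) * sin (real m * t) * fejer m t\<bar>)"
      by (rule abs_avg_le)
    also have "\<dots> \<le> avg M (\<lambda>t. K * fejer m t)"
    proof (rule avg_mono)
      fix t
      have "\<bar>F (\<theta> + t)\<bar> * \<bar>sin (real m * t)\<bar> \<le> K * 1"
        by (intro mult_mono absF) (use absF[of 0] in auto)
      then show "\<bar>F (\<theta> + t) * sin (real m * t) * fejer m t\<bar> \<le> K * fejer m t"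
        using fejer_nonneg[of m t] by (simp add: abs_mult mult_right_mono)
    qed
    also have "\<dots> = K / real m"
      using False by (simp add: avg_cmult avg_fejer M_def)
    finally have "(2 * (real m)\<^sup>2) * \<bar>avg M (\<lambda>t. F (\<theta> + t) * sin (real m * t) * fejer m t)\<bar>
        \<le> (2 * (real m)\<^sup>2) * (K / real m)"
      by (intro mult_left_mono) auto
    then show ?thesis unfolding repr abs_mult using False by (simp add: power2_eq_square)
  qed
  have "\<bar>F a - F b\<bar> \<le> 2 * real m * K * \<bar>a - b\<bar>"
    using field_differentiable_bound[of UNIV F F' "2 * real m * K" a b] deriv absF'
    by (simp add: abs_minus_commute)
  then show ?thesis by (simp add: F)
qed

section \<open>Lagrange interpolation and nearly Fekete points\<close>

definition lag :: "real set \<Rightarrow> real \<Rightarrow> real poly" where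
  "lag A a = (\<Prod>b\<in>A - {a}. smult (1 / (a - b)) [:- b, 1:])"

lemma poly_lag: "poly (lag A a) x = (\<Prod>b\<in>A - {a}. (x - b) / (a - b))"
  unfolding lag_def poly_prod by (intro prod.cong) (auto simp: diff_divide_distrib)

lemma degree_lag:
  assumes "finite A" "a \<in> A"
  shows "degree (lag A a) < card A"
proof -
  have "degree (lag A a) \<le> (\<Sum>b\<in>A - {a}. degree (smult (1 / (a - b)) [:- b, 1:]))"
    unfolding lag_def using assms(1) by (intro order_trans[OF degree_prod_sum_le]) (auto simp: comp_def)
  also have "\<dots> \<le> (\<Sum>b\<in>A - {a}. 1)"
    by (intro sum_mono) (auto simp: degree_smult_eq)
  also have "\<dots> < card A" using assms by (metis card_Diff1_less card_eq_sum)
  finally show ?thesis .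
qed

lemma poly_lag_node:
  assumes "finite A" "a \<in> A" "x \<in> A"
  shows "poly (lag A a) x = (if x = a then 1 else 0)"
  using assms by (auto simp: poly_lag)

lemma lagrange_interpolation:
  assumes "finite A" "degree p < card A"
  shows "poly p x = (\<Sum>a\<in>A. poly p a * poly (lag A a) x)"
proof -
  define r where "r = (\<Sum>a\<in>A. smult (poly p a) (lag A a))"
  have "degree r < card A"
  proof -
    have "degree r \<le> card A - 1" unfolding r_def
    proof (rule degree_sum_le[OF assms(1)])
      fix a assume "a \<in> A"
      then show "degree (smult (poly p a) (lag A a)) \<le> card A - 1"
        using degree_lag[OF assms(1)] degree_smult_le[of "poly p a" "lag A a"] by fastforce
    qed
    then show ?thesis using assms by linarith
  qed
  moreover have "poly r b = poly p b" if "b \<in> A" for b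
  proof -
    have "poly r b = (\<Sum>a\<in>A. if a = b then poly p a else 0)"
      unfolding r_def poly_sum using that assms(1)
      by (intro sum.cong refl) (auto simp: poly_lag_node)
    then show ?thesis using that assms(1) by simp
  qed
  ultimately have "p = r" using assms by (intro poly_eqI_degree[of A]) auto
  then show ?thesis by (metis (no_types, lifting) poly_smult poly_sum r_def sum.cong)
qed

definition vdm :: "real set \<Rightarrow> real" where
  "vdm A = (\<Prod>a\<in>A. \<Prod>b\<in>A - {a}. \<bar>a - b\<bar>)"

lemma vdm_pos: "finite A \<Longrightarrow> 0 < vdm A"
  unfolding vdm_def by (intro prod_pos) auto

lemma vdm_le:
  assumes "finite A" "A \<subseteq> {-1..1}"
  shows "vdm A \<le> (2 ^ card A) ^ card A"
proof -
  have "(\<Prod>b\<in>A - {a}. \<bar>a - b\<bar>) \<le> 2 ^ card A" if "a \<in> A" for a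
  proof -
    have "(\<Prod>b\<in>A - {a}. \<bar>a - b\<bar>) \<le> (\<Prod>b\<in>A - {a}. 2)"
    proof (rule prod_mono)
      fix b assume "b \<in> A - {a}"
      then have "a \<in> {-1..1}" "b \<in> {-1..1}" using that assms(2) by blast+
      then show "0 \<le> \<bar>a - b\<bar> \<and> \<bar>a - b\<bar> \<le> 2" by auto
    qed
    also have "\<dots> = 2 ^ card (A - {a})" by simp
    also have "\<dots> \<le> 2 ^ card A"
      by (rule power_increasing) (auto intro: card_Diff1_le)
    finally show ?thesis .
  qed
  then have "vdm A \<le> (\<Prod>a\<in>A. 2 ^ card A)"
    unfolding vdm_def by (intro prod_mono) (auto intro: prod_nonneg)
  then show ?thesis by simp
qed

text \<open>Every pair enters \<open>vdm\<close> in both orders, so \<open>vdm\<close> is the square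
  of the Vandermonde determinant, and a new point contributes the square of its product of
  distances.\<close>

lemma vdm_insert:
  assumes "finite B" "x \<notin> B"
  shows "vdm (insert x B) = vdm B * (\<Prod>b\<in>B. \<bar>x - b\<bar>)\<^sup>2"
proof -
  have "(\<Prod>b\<in>insert x B - {a}. \<bar>a - b\<bar>) = \<bar>x - a\<bar> * (\<Prod>b\<in>B - {a}. \<bar>a - b\<bar>)" if "a \<in> B" for a
  proof -
    have "insert x B - {a} = insert x (B - {a})" using that assms by auto
    then show ?thesis using assms by (simp add: abs_minus_commute)
  qed
  then have "(\<Prod>a\<in>B. \<Prod>b\<in>insert x B - {a}. \<bar>a - b\<bar>) = (\<Prod>a\<in>B. \<bar>x - a\<bar>) * vdm B"
    by (simp add: vdm_def prod.distrib)
  moreover have "insert x B - {x} = B" using assms by auto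
  ultimately show ?thesis
    unfolding vdm_def[of "insert x B"] using assms by (simp add: power2_eq_square mult_ac)
qed

text \<open>Both sides contain the factor \<open>vdm (A - {z})\<close>, and the fundamental
  polynomial is, up to sign, the quotient of the two remaining products of distances.\<close>

lemma vdm_mult_lag_square:
  assumes "finite A" "z \<in> A" "x \<notin> A"
  shows "vdm A * (poly (lag A z) x)\<^sup>2 = vdm (insert x (A - {z}))"
proof -
  let ?B = "A - {z}"
  have pz: "(\<Prod>b\<in>?B. \<bar>z - b\<bar>) \<noteq> 0" using assms by auto
  have "(poly (lag A z) x)\<^sup>2 = (\<Prod>b\<in>?B. \<bar>x - b\<bar>)\<^sup>2 / (\<Prod>b\<in>?B. \<bar>z - b\<bar>)\<^sup>2"
    by (simp add: poly_lag prod_dividef power_divide abs_prod[symmetric])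
  moreover have "vdm A = vdm ?B * (\<Prod>b\<in>?B. \<bar>z - b\<bar>)\<^sup>2"
    using vdm_insert[of ?B z] assms by (simp add: insert_absorb)
  moreover have "vdm (insert x ?B) = vdm ?B * (\<Prod>b\<in>?B. \<bar>x - b\<bar>)\<^sup>2"
    using assms by (intro vdm_insert) auto
  ultimately show ?thesis using pz by simp
qed

text \<open>
  Replacing \<open>z\<close> by \<open>x\<close> multiplies \<open>vdm\<close> by the square of the fundamental polynomial, so it
  suffices that \<open>Z\<close> attains a quarter of the supremum of \<open>vdm\<close>; compactness is not needed.
\<close>
lemma exists_near_fekete:
  assumes "finite X" "X \<subseteq> {-1..1::real}"
  shows "\<exists>Z. finite Z \<and> card Z = d \<and> Z \<subseteq> {-1..1} \<and> X \<inter> Z = {} \<and>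
    (\<forall>z\<in>Z. \<forall>x\<in>{-1..1}. \<bar>poly (lag (X \<union> Z) z) x\<bar> \<le> 2)"
proof -
  define \<Z> where "\<Z> = {Z. finite Z \<and> card Z = d \<and> Z \<subseteq> {-1..1::real} \<and> X \<inter> Z = {}}"
  define V where "V = (\<lambda>Z. vdm (X \<union> Z)) ` \<Z>"
  have "infinite ({-1..1::real} - X)"
    using assms(1) infinite_Icc[of "-1" "1::real"] by (simp add: Diff_infinite_finite)
  then obtain Z\<^sub>0 where Z\<^sub>0: "finite Z\<^sub>0" "card Z\<^sub>0 = d" "Z\<^sub>0 \<subseteq> {-1..1} - X"
    using infinite_arbitrarily_large by blast
  then have Z\<^sub>0_in: "Z\<^sub>0 \<in> \<Z>" by (auto simp: \<Z>_def)
  have "bdd_above V"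
  proof (rule bdd_aboveI)
    fix v assume "v \<in> V"
    then obtain Z where Z: "Z \<in> \<Z>" "v = vdm (X \<union> Z)" by (auto simp: V_def)
    have "card (X \<union> Z) = card X + d" using Z assms by (auto simp: \<Z>_def card_Un_disjoint)
    then show "v \<le> (2 ^ (card X + d)) ^ (card X + d)"
      using vdm_le[of "X \<union> Z"] Z assms by (auto simp: \<Z>_def)
  qed
  moreover have "vdm (X \<union> Z\<^sub>0) > 0" using Z\<^sub>0 assms by (intro vdm_pos) auto
  moreover have "vdm (X \<union> Z\<^sub>0) \<in> V" using Z\<^sub>0_in by (auto simp: V_def)
  ultimately have "Sup V > 0" by (meson cSup_upper order_less_le_trans)
  then have "Sup V / 4 < Sup V" by simp
  then obtain v where "v \<in> V" "Sup V / 4 < v" using \<open>vdm (X \<union> Z\<^sub>0) \<in> V\<close> less_cSupE by blast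
  then obtain Z where Z: "Z \<in> \<Z>" "Sup V / 4 < vdm (X \<union> Z)" by (auto simp: V_def)
  have "\<bar>poly (lag (X \<union> Z) z) x\<bar> \<le> 2" if "z \<in> Z" "x \<in> {-1..1}" for z x
  proof (cases "x \<in> X \<union> Z")
    case True
    then show ?thesis using that Z assms by (auto simp: poly_lag_node \<Z>_def)
  next
    case False
    have fin: "finite (X \<union> Z)" using Z assms by (auto simp: \<Z>_def)
    have "card (insert x (Z - {z})) = d"
      using that Z False by (auto simp: \<Z>_def card_Suc_Diff1 simp del: card_Diff_singleton card_Diff_insert)
    then have "insert x (Z - {z}) \<in> \<Z>"
      using that Z False by (auto simp: \<Z>_def)
    then have "vdm (X \<union> insert x (Z - {z})) \<in> V" unfolding V_def by (rule imageI)
    moreover have "X \<union> insert x (Z - {z}) = insert x (X \<union> Z - {z})"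
      using that Z by (auto simp: \<Z>_def)
    ultimately have "vdm (insert x (X \<union> Z - {z})) \<le> Sup V"
      using \<open>bdd_above V\<close> by (simp add: cSup_upper)
    then have "vdm (X \<union> Z) * (poly (lag (X \<union> Z) z) x)\<^sup>2 \<le> vdm (X \<union> Z) * 4"
      using vdm_mult_lag_square[OF fin, of z x] that False Z(2) by auto
    then have "(poly (lag (X \<union> Z) z) x)\<^sup>2 \<le> 2\<^sup>2"
      using vdm_pos[OF fin] by simp
    then show ?thesis using abs_le_square_iff[of "poly (lag (X \<union> Z) z) x" 2] by simp
  qed
  then show ?thesis using Z by (intro exI[of _ Z]) (auto simp: \<Z>_def)
qed

section \<open>Symmetrized Fejer kernels and separated nodes\<close>

text \<open>Symmetrization makes the translated kernel even in \<open>\<theta>\<close>, hence a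
  polynomial of degree less than \<open>q\<close> in \<open>cos \<theta>\<close>, which can be
  multiplied into an interpolated polynomial.\<close>

definition kern :: "nat \<Rightarrow> real \<Rightarrow> real \<Rightarrow> real" where
  "kern q t \<theta> = fejer q (\<theta> - t) + fejer q (\<theta> + t)"

lemma kern_nonneg: "0 \<le> kern q t \<theta>"
  by (simp add: kern_def fejer_nonneg)

lemma kern_le_2: "kern q t \<theta> \<le> 2"
  using fejer_le_1[of q "\<theta> - t"] fejer_le_1[of q "\<theta> + t"] by (simp add: kern_def)

lemma kern_self: "0 < q \<Longrightarrow> 1 \<le> kern q t t"
  using fejer_nonneg[of q "t + t"] by (simp add: kern_def fejer_0)

lemma kern_expansion:
  "kern q t \<theta> = (\<Sum>a<q. \<Sum>b<q. 2 * cos ((real a - real b) * t) * cos ((real a - real b) * \<theta>)) / (real q)\<^sup>2"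
proof -
  have "cos (c * (\<theta> - t)) + cos (c * (\<theta> + t)) = 2 * cos (c * t) * cos (c * \<theta>)" for c
    by (simp add: right_diff_distrib distrib_left cos_add cos_diff)
  then show ?thesis
    by (simp add: kern_def fejer_def sum.distrib[symmetric] add_divide_distrib[symmetric])
qed

lemma cos_cos_diff: "cos ((real a - real b) * t) = poly (cheb (nat \<bar>int a - int b\<bar>)) (cos t)"
proof -
  have "real (nat \<bar>int a - int b\<bar>) = \<bar>real a - real b\<bar>" by simp
  then have "poly (cheb (nat \<bar>int a - int b\<bar>)) (cos t) = cos (\<bar>real a - real b\<bar> * t)"
    by (simp only: poly_cheb_cos)
  also have "\<dots> = cos ((real a - real b) * t)"
    using cos_minus[of "(real a - real b) * t"] by (simp add: abs_if left_diff_distrib)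
  finally show ?thesis by simp
qed

lemma kern_poly:
  assumes "0 < q"
  shows "\<exists>p. degree p < q \<and> (\<forall>\<theta>. poly p (cos \<theta>) = kern q t \<theta>)"
proof (intro exI conjI allI)
  let ?p = "smult (1 / (real q)\<^sup>2) (\<Sum>a<q. \<Sum>b<q. smult (2 * cos ((real a - real b) * t)) (cheb (nat \<bar>int a - int b\<bar>)))"
  show "degree ?p < q"
  proof -
    have "degree (\<Sum>a<q. \<Sum>b<q. smult (2 * cos ((real a - real b) * t)) (cheb (nat \<bar>int a - int b\<bar>))) \<le> q - 1"
    proof (intro degree_sum_le finite_lessThan)
      fix a b assume "a \<in> {..<q}" "b \<in> {..<q}"
      then have "nat \<bar>int a - int b\<bar> \<le> q - 1" by auto
      then show "degree (smult (2 * cos ((real a - real b) * t)) (cheb (nat \<bar>int a - int b\<bar>))) \<le> q - 1"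
        by (intro order_trans[OF degree_smult_le] order_trans[OF degree_cheb])
    qed
    then have "degree ?p \<le> q - 1" by (rule order_trans[OF degree_smult_le])
    then show ?thesis using assms by linarith
  qed
  show "poly ?p (cos \<theta>) = kern q t \<theta>" for \<theta>
    unfolding kern_expansion cos_cos_diff[of _ _ \<theta>] poly_smult poly_sum by simp
qed

text \<open>By \<open>kern_expansion\<close> the centre \<open>t\<close> enters through
  \<open>cos t\<close> only, so an arbitrary centre can be moved into \<open>[0, pi]\<close>, where
  the decay estimate applies.\<close>

lemma kern_arccos: "kern q (arccos (cos t)) \<theta> = kern q t \<theta>"
proof -
  have "cos (arccos (cos t)) = cos t" by (simp add: cos_arccos)
  then have "cos ((real a - real b) * arccos (cos t)) = cos ((real a - real b) * t)" for a b
    by (simp only: cos_cos_diff)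
  then show ?thesis unfolding kern_expansion by (simp only:)
qed

lemma avg_kern:
  assumes "0 < q" "q \<le> M"
  shows "avg M (\<lambda>t. kern q t \<theta>) = 2 / real q"
  unfolding kern_def avg_add using avg_fejer_shift[OF assms(2,1)] by simp

section \<open>Decay of the kernels and sums over separated angles\<close>

lemma half_le_sin:
  fixes x :: real
  assumes "0 \<le> x" "x \<le> pi / 2"
  shows "x / 2 \<le> sin x"
proof (cases "x \<le> pi / 3")
  case True
  have "sin 0 - 0 / 2 \<le> sin x - x / 2"
  proof (rule DERIV_nonneg_imp_nondecreasing[OF assms(1)])
    fix y assume y: "0 \<le> y" "y \<le> x"
    have "((\<lambda>x. sin x - x / 2) has_real_derivative cos y - 1 / 2) (at y)"
      by (auto intro!: derivative_eq_intros)
    moreover have "cos (pi / 3) \<le> cos y"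
      using y True by (intro cos_monotone_0_pi_le) auto
    ultimately show "\<exists>d. ((\<lambda>x. sin x - x / 2) has_real_derivative d) (at y) \<and> 0 \<le> d"
      by (auto simp: cos_60)
  qed
  then show ?thesis by simp
next
  case False
  \<comment> \<open>Beyond \<open>pi / 3\<close> the derivative argument fails, but there the sine
    is at least \<open>sqrt 3 / 2\<close>, which exceeds \<open>pi / 4 \<ge> x / 2\<close>.\<close>
  have "sin (pi / 3) \<le> sin x"
    using False assms by (intro sin_monotone_2pi_le) auto
  moreover have "1.7 \<le> sqrt 3" by (rule real_le_rsqrt) (simp add: power2_eq_square)
  ultimately show ?thesis using assms(2) pi_less_4 pi_approx by (simp add: sin_60)
qed

text \<open>For angles in \<open>[0, pi]\<close> the reflected term is no worse than the direct one,
  because \<open>|sin ((\<theta> - t) / 2)| \<le> |sin ((\<theta> + t) / 2)|\<close>. Each of the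
  two Fejer kernels then contributes 16.\<close>

lemma kern_decay:
  assumes "t \<in> {0..pi}" "\<theta> \<in> {0..pi}"
  shows "kern q t \<theta> * ((real q)\<^sup>2 * (\<theta> - t)\<^sup>2) \<le> 32"
proof -
  have 1: "\<bar>\<theta> - t\<bar> / 4 \<le> \<bar>sin ((\<theta> - t) / 2)\<bar>"
  proof -
    have "\<bar>\<theta> - t\<bar> / 2 / 2 \<le> sin (\<bar>\<theta> - t\<bar> / 2)"
      using assms by (intro half_le_sin) (auto simp: abs_if)
    also have "\<dots> \<le> \<bar>sin ((\<theta> - t) / 2)\<bar>"
      using sin_minus[of "(\<theta> - t) / 2"] by (cases "\<theta> \<ge> t") (auto simp: minus_divide_left)
    finally show ?thesis by simp
  qed
  have "0 \<le> sin (\<theta> / 2)" "0 \<le> cos (\<theta> / 2)" "0 \<le> sin (t / 2)" "0 \<le> cos (t / 2)"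
    using assms by (auto intro!: sin_ge_zero cos_ge_zero)
  then have "\<bar>sin ((\<theta> - t) / 2)\<bar> \<le> \<bar>sin ((\<theta> + t) / 2)\<bar>"
    by (simp add: add_divide_distrib diff_divide_distrib sin_add sin_diff abs_le_iff)
  with 1 have 2: "\<bar>\<theta> - t\<bar> / 4 \<le> \<bar>sin ((\<theta> + t) / 2)\<bar>" by linarith
  have "fejer q s * ((real q)\<^sup>2 * (\<theta> - t)\<^sup>2) \<le> 16" if "\<bar>\<theta> - t\<bar> / 4 \<le> \<bar>sin (s / 2)\<bar>" for s
  proof -
    have "(\<theta> - t)\<^sup>2 / 16 \<le> (sin (s / 2))\<^sup>2"
      using power_mono[OF that, of 2] by (simp add: power_divide)
    then have "fejer q s * ((real q)\<^sup>2 * ((\<theta> - t)\<^sup>2 / 16)) \<le> fejer q s * ((real q)\<^sup>2 * (sin (s / 2))\<^sup>2)"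
      by (intro mult_left_mono fejer_nonneg) auto
    also have "\<dots> \<le> 1" using fejer_bound[of q s] by (simp add: power_mult_distrib)
    finally show ?thesis by simp
  qed
  from this[OF 1] this[OF 2] show ?thesis by (simp add: kern_def distrib_right)
qed

text \<open>Terms after the first are dominated by the telescoping differences
  \<open>1 / (k - 1) - 1 / k\<close>; keeping \<open>- 1 / B\<close> on the right makes the
  induction close.\<close>

lemma sum_inverse_squares_le:
  assumes "1 \<le> W" "W \<le> B"
  shows "(\<Sum>k=W..B. 1 / (real k)\<^sup>2) \<le> 2 / real W - 1 / real B"
  using assms(2)
proof (induction B rule: dec_induct)
  case base
  have "1 / (real W)\<^sup>2 \<le> 1 / real W"
    using assms(1) by (intro divide_left_mono) (auto simp: power2_eq_square)
  then show ?case by simp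
next
  case (step B)
  have "1 / (real (Suc B))\<^sup>2 \<le> 1 / real B - 1 / real (Suc B)"
  proof -
    have "1 / real B - 1 / real (Suc B) = 1 / (real B * real (Suc B))"
      using step assms by (simp add: field_simps)
    moreover have "1 / (real (Suc B))\<^sup>2 \<le> 1 / (real B * real (Suc B))"
      using step assms by (intro divide_left_mono) (auto simp: power2_eq_square mult_right_mono)
    ultimately show ?thesis by simp
  qed
  then show ?case using step by simp
qed

text \<open>Rounding \<open>g u / \<delta>\<close> down is injective on a
  \<open>\<delta>\<close>-separated set, so counts and sums of inverse squares are compared with
  those over distinct natural numbers.\<close>

lemma separated_one_sided:
  fixes g :: "'a \<Rightarrow> real"
  assumes "finite Y" "0 < \<delta>" and nonneg: "\<And>u. u \<in> Y \<Longrightarrow> 0 \<le> g u"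
    and sep: "\<And>u v. u \<in> Y \<Longrightarrow> v \<in> Y \<Longrightarrow> u \<noteq> v \<Longrightarrow> \<delta> \<le> \<bar>g u - g v\<bar>"
  shows "card {u \<in> Y. g u < real W * \<delta>} \<le> W"
    and "1 \<le> W \<Longrightarrow> (\<Sum>u | u \<in> Y \<and> real W * \<delta> \<le> g u. 1 / (g u)\<^sup>2) \<le> 2 / (\<delta>\<^sup>2 * real W)"
proof -
  define f where "f u = nat \<lfloor>g u / \<delta>\<rfloor>" for u
  have f: "real (f u) \<le> g u / \<delta>" "g u / \<delta> < real (f u) + 1" if "u \<in> Y" for u
    using nonneg[OF that] \<open>0 < \<delta>\<close> by (auto simp: f_def)
  have "inj_on f Y"
  proof (rule inj_onI, rule ccontr)
    fix u v assume uv: "u \<in> Y" "v \<in> Y" "f u = f v" "u \<noteq> v"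
    then have "\<bar>g u / \<delta> - g v / \<delta>\<bar> < 1" using f[of u] f[of v] by linarith
    then have "\<bar>g u - g v\<bar> < \<delta>" using \<open>0 < \<delta>\<close> by (simp add: diff_divide_distrib[symmetric] abs_divide)
    with sep uv show False by fastforce
  qed
  note inj = inj_on_subset[OF this]
  have "f ` {u \<in> Y. g u < real W * \<delta>} \<subseteq> {..<W}"
  proof
    fix k assume "k \<in> f ` {u \<in> Y. g u < real W * \<delta>}"
    then obtain u where u: "u \<in> Y" "g u < real W * \<delta>" "k = f u" by auto
    then have "g u / \<delta> < real W" using \<open>0 < \<delta>\<close> by (simp add: divide_less_eq)
    then show "k \<in> {..<W}" using f(1)[OF u(1)] u(3) by simp
  qed
  then show "card {u \<in> Y. g u < real W * \<delta>} \<le> W"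
    using card_inj_on_le[of f _ "{..<W}"] inj by (metis (no_types, lifting) card_lessThan finite_lessThan mem_Collect_eq subsetI)
  assume W: "1 \<le> W"
  define Y' where "Y' = {u \<in> Y. real W * \<delta> \<le> g u}"
  have Y': "finite Y'" "Y' \<subseteq> Y" using assms(1) by (auto simp: Y'_def)
  have fW: "W \<le> f u" if "u \<in> Y'" for u
  proof -
    have "real W \<le> g u / \<delta>" using that \<open>0 < \<delta>\<close> by (simp add: Y'_def le_divide_eq)
    then show ?thesis by (simp add: f_def le_nat_floor)
  qed
  \<comment> \<open>Any common upper bound of \<open>W\<close> and the values of \<open>f\<close>
    would do; the tail estimate does not depend on it.\<close>
  define B where "B = W + (\<Sum>u\<in>Y'. f u)"
  have fB: "f u \<le> B" if "u \<in> Y'" for u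
    using member_le_sum[of u Y' f] that Y' by (simp add: B_def)
  have "(\<Sum>u\<in>Y'. 1 / (g u)\<^sup>2) \<le> (\<Sum>u\<in>Y'. (1 / \<delta>\<^sup>2) * (1 / (real (f u))\<^sup>2))"
  proof (rule sum_mono)
    fix u assume u: "u \<in> Y'"
    then have "real (f u) * \<delta> \<le> g u" using f(1)[of u] Y' \<open>0 < \<delta>\<close> by (auto simp: le_divide_eq)
    moreover have "0 < real (f u) * \<delta>" using fW[OF u] W \<open>0 < \<delta>\<close> by simp
    ultimately have "1 / (g u)\<^sup>2 \<le> 1 / (real (f u) * \<delta>)\<^sup>2"
      by (intro divide_left_mono power_mono mult_pos_pos[OF zero_less_power zero_less_power]) auto
    then show "1 / (g u)\<^sup>2 \<le> (1 / \<delta>\<^sup>2) * (1 / (real (f u))\<^sup>2)"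
      by (simp add: power_mult_distrib mult.commute)
  qed
  also have "\<dots> = (1 / \<delta>\<^sup>2) * (\<Sum>k\<in>f ` Y'. 1 / (real k)\<^sup>2)"
    by (simp add: sum.reindex[OF inj[OF Y'(2)]] sum_distrib_left)
  also have "\<dots> \<le> (1 / \<delta>\<^sup>2) * (\<Sum>k=W..B. 1 / (real k)\<^sup>2)"
    using fW fB by (intro mult_left_mono sum_mono2) auto
  also have "\<dots> \<le> (1 / \<delta>\<^sup>2) * (2 / real W)"
  proof (intro mult_left_mono)
    have "0 \<le> 1 / real B" by simp
    then show "(\<Sum>k=W..B. 1 / (real k)\<^sup>2) \<le> 2 / real W"
      using sum_inverse_squares_le[of W B] W unfolding B_def by linarith
  qed simp
  finally show "(\<Sum>u | u \<in> Y \<and> real W * \<delta> \<le> g u. 1 / (g u)\<^sup>2) \<le> 2 / (\<delta>\<^sup>2 * real W)"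
    by (simp add: Y'_def)
qed

lemma separated_two_sided:
  fixes \<theta> :: "'a \<Rightarrow> real"
  assumes "finite Y" "0 < \<delta>"
    and sep: "\<And>u v. u \<in> Y \<Longrightarrow> v \<in> Y \<Longrightarrow> u \<noteq> v \<Longrightarrow> \<delta> \<le> \<bar>\<theta> u - \<theta> v\<bar>"
  shows "card {u \<in> Y. \<bar>\<theta> u - t\<bar> < real W * \<delta>} \<le> 2 * W"
    and "1 \<le> W \<Longrightarrow> (\<Sum>u | u \<in> Y \<and> real W * \<delta> \<le> \<bar>\<theta> u - t\<bar>. 1 / (\<theta> u - t)\<^sup>2) \<le> 4 / (\<delta>\<^sup>2 * real W)"
proof -
  define P N where "P = {u \<in> Y. t \<le> \<theta> u}" and "N = {u \<in> Y. \<theta> u < t}"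
  have fin: "finite P" "finite N" using assms(1) by (auto simp: P_def N_def)
  have sepP: "\<delta> \<le> \<bar>(\<theta> u - t) - (\<theta> v - t)\<bar>" if "u \<in> P" "v \<in> P" "u \<noteq> v" for u v
    using sep[of u v] that by (auto simp: P_def)
  have sepN: "\<delta> \<le> \<bar>(t - \<theta> u) - (t - \<theta> v)\<bar>" if "u \<in> N" "v \<in> N" "u \<noteq> v" for u v
    using sep[of u v] that by (auto simp: N_def)
  note p = separated_one_sided[OF fin(1) assms(2), of "\<lambda>u. \<theta> u - t", OF _ sepP]
  note n = separated_one_sided[OF fin(2) assms(2), of "\<lambda>u. t - \<theta> u", OF _ sepN]
  have "{u \<in> Y. \<bar>\<theta> u - t\<bar> < real W * \<delta>} = {u \<in> P. \<theta> u - t < real W * \<delta>} \<union> {u \<in> N. t - \<theta> u < real W * \<delta>}"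
    by (auto simp: P_def N_def)
  then have "card {u \<in> Y. \<bar>\<theta> u - t\<bar> < real W * \<delta>} \<le> card {u \<in> P. \<theta> u - t < real W * \<delta>} + card {u \<in> N. t - \<theta> u < real W * \<delta>}"
    by (simp add: card_Un_le)
  also have "\<dots> \<le> W + W"
    by (intro add_mono p(1) n(1)) (auto simp: P_def N_def)
  finally show "card {u \<in> Y. \<bar>\<theta> u - t\<bar> < real W * \<delta>} \<le> 2 * W" by simp
  assume W: "1 \<le> W"
  have "(\<Sum>u | u \<in> Y \<and> real W * \<delta> \<le> \<bar>\<theta> u - t\<bar>. 1 / (\<theta> u - t)\<^sup>2)
    = (\<Sum>u\<in>{u. u \<in> P \<and> real W * \<delta> \<le> \<theta> u - t} \<union> {u. u \<in> N \<and> real W * \<delta> \<le> t - \<theta> u}. 1 / (\<theta> u - t)\<^sup>2)"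
    by (rule sum.cong) (auto simp: P_def N_def)
  also have "\<dots> = (\<Sum>u | u \<in> P \<and> real W * \<delta> \<le> \<theta> u - t. 1 / (\<theta> u - t)\<^sup>2)
     + (\<Sum>u | u \<in> N \<and> real W * \<delta> \<le> t - \<theta> u. 1 / (t - \<theta> u)\<^sup>2)"
    by (subst sum.union_disjoint) (use assms(1) in \<open>auto simp: P_def N_def power2_commute[of _ t]\<close>)
  also have "\<dots> \<le> 2 / (\<delta>\<^sup>2 * real W) + 2 / (\<delta>\<^sup>2 * real W)"
    by (intro add_mono p(2) n(2) W) (auto simp: P_def N_def)
  finally show "(\<Sum>u | u \<in> Y \<and> real W * \<delta> \<le> \<bar>\<theta> u - t\<bar>. 1 / (\<theta> u - t)\<^sup>2) \<le> 4 / (\<delta>\<^sup>2 * real W)"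
    by (simp add: mult.commute)
qed

lemma kern_tail:
  fixes \<theta> :: "'a \<Rightarrow> real"
  assumes "finite Y" "0 < \<delta>" "0 < q" "1 \<le> W" "t \<in> {0..pi}" "\<And>u. u \<in> Y \<Longrightarrow> \<theta> u \<in> {0..pi}"
    and sep: "\<And>u v. u \<in> Y \<Longrightarrow> v \<in> Y \<Longrightarrow> u \<noteq> v \<Longrightarrow> \<delta> \<le> \<bar>\<theta> u - \<theta> v\<bar>"
  shows "(\<Sum>u | u \<in> Y \<and> real W * \<delta> \<le> \<bar>\<theta> u - t\<bar>. kern q t (\<theta> u)) \<le> 128 / ((real q)\<^sup>2 * \<delta>\<^sup>2 * real W)"
proof -
  have "(\<Sum>u | u \<in> Y \<and> real W * \<delta> \<le> \<bar>\<theta> u - t\<bar>. kern q t (\<theta> u))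
    \<le> (\<Sum>u | u \<in> Y \<and> real W * \<delta> \<le> \<bar>\<theta> u - t\<bar>. 32 / (real q)\<^sup>2 * (1 / (\<theta> u - t)\<^sup>2))"
  proof (rule sum_mono)
    fix u assume u: "u \<in> {u. u \<in> Y \<and> real W * \<delta> \<le> \<bar>\<theta> u - t\<bar>}"
    moreover have "0 < real W * \<delta>" using assms by simp
    ultimately have "0 < (real q)\<^sup>2 * (\<theta> u - t)\<^sup>2" using \<open>0 < q\<close> by auto
    then show "kern q t (\<theta> u) \<le> 32 / (real q)\<^sup>2 * (1 / (\<theta> u - t)\<^sup>2)"
      using kern_decay[of t "\<theta> u" q] assms(5,6) u by (simp add: pos_le_divide_eq)
  qed
  also have "\<dots> = 32 / (real q)\<^sup>2 * (\<Sum>u | u \<in> Y \<and> real W * \<delta> \<le> \<bar>\<theta> u - t\<bar>. 1 / (\<theta> u - t)\<^sup>2)"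
    by (simp add: sum_distrib_left)
  also have "\<dots> \<le> 32 / (real q)\<^sup>2 * (4 / (\<delta>\<^sup>2 * real W))"
    using separated_two_sided(2)[OF assms(1,2) sep assms(4)] by (intro mult_left_mono) auto
  finally show ?thesis by (simp add: mult_ac)
qed

section \<open>A logarithmic lower bound for averaged interpolation\<close>

lemma abs_sin_nat_le: "\<bar>sin (real k * s)\<bar> \<le> real k * \<bar>sin s\<bar>"
proof (induction k)
  case (Suc k)
  have "\<bar>sin (real (Suc k) * s)\<bar> \<le> \<bar>sin (real k * s)\<bar> * \<bar>cos s\<bar> + \<bar>cos (real k * s)\<bar> * \<bar>sin s\<bar>"
    using abs_triangle_ineq[of "cos s * sin (real k * s)" "sin s * cos (real k * s)"]
    by (simp add: distrib_right distrib_left sin_add abs_mult mult.commute add.commute)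
  also have "\<dots> \<le> \<bar>sin (real k * s)\<bar> * 1 + 1 * \<bar>sin s\<bar>"
    by (intro add_mono mult_left_mono mult_right_mono) auto
  finally show ?case using Suc by (simp add: distrib_right)
qed auto

text \<open>Abel summation carried out by induction: with the boundary term
  \<open>c (Suc N) / N\<close> included, raising \<open>N\<close> by one changes the expression by
  at most \<open>1 / N - 1 / (N + 1)\<close>, and these changes telescope.\<close>

lemma abel_tail:
  fixes c :: "nat \<Rightarrow> real"
  assumes c: "\<And>k. \<bar>c k\<bar> \<le> 1" and "1 \<le> a" "a \<le> N"
  shows "\<bar>(\<Sum>k=a..N. (c k - c (Suc k)) / real k) + c (Suc N) / real N\<bar> \<le> 2 / real a - 1 / real N"
  using assms(3)
proof (induction N rule: dec_induct)
  case base
  have "(c a - c (Suc a)) / real a + c (Suc a) / real a = c a / real a"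
    by (simp add: diff_divide_distrib)
  then show ?case using c[of a] assms(2) by (simp add: divide_right_mono)
next
  case (step N)
  have N: "0 < real N" using step assms by simp
  have eq: "(\<Sum>k=a..Suc N. (c k - c (Suc k)) / real k) + c (Suc (Suc N)) / real (Suc N)
    = ((\<Sum>k=a..N. (c k - c (Suc k)) / real k) + c (Suc N) / real N)
      - c (Suc N) * (1 / real N - 1 / real (Suc N))"
    using step N by (simp add: diff_divide_distrib right_diff_distrib)
  have le: "\<bar>c (Suc N) * (1 / real N - 1 / real (Suc N))\<bar> \<le> 1 * (1 / real N - 1 / real (Suc N))"
  proof -
    have "0 \<le> 1 / real N - 1 / real (Suc N)" using N by (simp add: divide_left_mono)
    then show ?thesis unfolding abs_mult by (intro mult_mono c) auto
  qed
  show ?case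
    unfolding eq using order_trans[OF abs_triangle_ineq4 add_mono[OF step.IH le]] by simp
qed

text \<open>The sum is split near \<open>k = 1 / r\<close> with \<open>r = |sin (s / 2)|\<close>.
  Each low term is at most \<open>2 * r\<close>, which gives 2 in total; Abel summation bounds the
  high part by 1.\<close>

lemma abs_sum_sin_over_le: "\<bar>\<Sum>k=1..N. sin (real k * s) / real k\<bar> \<le> 3"
proof (cases "sin (s / 2) = 0")
  case True
  then have "sin s = 0" using sin_double[of "s / 2"] by simp
  then have "sin (real k * s) = 0" for k using abs_sin_nat_le[of k s] by simp
  then show ?thesis by simp
next
  case False
  define r where "r = \<bar>sin (s / 2)\<bar>"
  have r: "0 < r" "r \<le> 1" using False by (auto simp: r_def)
  have "\<bar>sin s\<bar> = 2 * r * \<bar>cos (s / 2)\<bar>"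
    using sin_double[of "s / 2"] by (simp add: r_def abs_mult)
  also have "\<dots> \<le> 2 * r * 1" using r by (intro mult_left_mono) auto
  finally have sin_s: "\<bar>sin s\<bar> \<le> 2 * r" by simp
  \<comment> \<open>The minimum with \<open>N\<close> covers the case that all terms are
    low.\<close>
  define a where "a = min N (nat \<lfloor>1 / r\<rfloor>)"
  have ar: "real a * r \<le> 1"
  proof -
    have "real a \<le> real (nat \<lfloor>1 / r\<rfloor>)" by (simp add: a_def)
    also have "\<dots> \<le> 1 / r" using r by simp
    finally have "real a \<le> 1 / r" .
    then show ?thesis using r by (simp add: le_divide_eq)
  qed
  have low: "\<bar>\<Sum>k=1..a. sin (real k * s) / real k\<bar> \<le> 2"
  proof -
    have "\<bar>\<Sum>k=1..a. sin (real k * s) / real k\<bar> \<le> (\<Sum>k=1..a. \<bar>sin (real k * s) / real k\<bar>)"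
      by (rule sum_abs)
    also have "\<dots> \<le> (\<Sum>k=1..a. 2 * r)"
    proof (rule sum_mono)
      fix k assume "k \<in> {1..a}"
      then have "0 < real k" by simp
      then have "\<bar>sin (real k * s) / real k\<bar> \<le> \<bar>sin s\<bar>"
        using abs_sin_nat_le[of k s] by (simp add: divide_le_eq mult.commute)
      then show "\<bar>sin (real k * s) / real k\<bar> \<le> 2 * r" using sin_s by linarith
    qed
    finally show ?thesis using ar by simp
  qed
  show ?thesis
  proof (cases "a = N")
    case True
    then show ?thesis using low by simp
  next
    case False
    then have aN: "Suc a \<le> N" "1 / r < real (Suc a)" using r by (auto simp: a_def min_def split: if_splits) linarith
    \<comment> \<open>Half-integer frequencies make \<open>2 * sin (s / 2) * sin (k * s)\<close> the
      telescoping difference \<open>c k - c (Suc k)\<close>.\<close>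
    define c where "c k = cos ((real k - 1 / 2) * s)" for k
    have "2 * sin (s / 2) * (sin (real k * s) / real k) = (c k - c (Suc k)) / real k" for k
    proof -
      have "c k - c (Suc k) = 2 * sin (real k * s) * sin (s / 2)"
        unfolding c_def by (simp add: sin_times_sin algebra_simps)
      then show ?thesis by simp
    qed
    then have eq: "2 * sin (s / 2) * (\<Sum>k=Suc a..N. sin (real k * s) / real k)
       = (\<Sum>k=Suc a..N. (c k - c (Suc k)) / real k)" unfolding sum_distrib_left by (simp only:)
    have "\<bar>(\<Sum>k=Suc a..N. (c k - c (Suc k)) / real k) + c (Suc N) / real N\<bar> \<le> 2 / real (Suc a) - 1 / real N"
      using aN by (intro abel_tail) (auto simp: c_def)
    moreover have "\<bar>c (Suc N) / real N\<bar> \<le> 1 / real N" by (simp add: c_def divide_right_mono)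
    ultimately have "\<bar>2 * sin (s / 2) * (\<Sum>k=Suc a..N. sin (real k * s) / real k)\<bar> \<le> 2 / real (Suc a)"
      unfolding eq by linarith
    also have "2 / real (Suc a) \<le> 2 * r" using aN r by (simp add: field_simps)
    finally have "r * \<bar>\<Sum>k=Suc a..N. sin (real k * s) / real k\<bar> \<le> r * 1"
      by (simp add: abs_mult r_def)
    then have "\<bar>\<Sum>k=Suc a..N. sin (real k * s) / real k\<bar> \<le> 1" using r by simp
    moreover have "(\<Sum>k=1..N. sin (real k * s) / real k) =
       (\<Sum>k=1..a. sin (real k * s) / real k) + (\<Sum>k=Suc a..N. sin (real k * s) / real k)"
      using aN sum.ub_add_nat[of 1 a "\<lambda>k. sin (real k * s) / real k" "N - a"] by simp
    ultimately show ?thesis using low by linarith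
  qed
qed

lemma ln_le_sum_inverse:
  assumes "1 \<le> q" "q \<le> N"
  shows "ln (real (Suc N) / real q) \<le> (\<Sum>k=q..N. 1 / real k)"
  using assms(2)
proof (induction N rule: dec_induct)
  case base
  have "ln (real (Suc q) / real q) \<le> real (Suc q) / real q - 1"
    using assms by (intro ln_le_minus_one) auto
  also have "\<dots> = 1 / real q" using assms by (simp add: field_simps)
  finally show ?case by simp
next
  case (step N)
  have "ln (real (Suc (Suc N)) / real (Suc N)) \<le> real (Suc (Suc N)) / real (Suc N) - 1"
    by (intro ln_le_minus_one) auto
  also have "\<dots> = 1 / real (Suc N)" by (simp add: field_simps)
  finally have "ln (real (Suc (Suc N))) - ln (real (Suc N)) \<le> 1 / real (Suc N)" by (simp add: ln_div)
  then show ?case using step assms by (simp add: ln_div)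
qed

text \<open>
  By the Faber-Berman averaging argument, \<open>node_avg A M\<close> takes an even trigonometric polynomial
  without constant term to its Fourier partial sum of order \<open>card A - 1\<close> at 0.
\<close>
definition node_avg :: "real set \<Rightarrow> nat \<Rightarrow> (real \<Rightarrow> real) \<Rightarrow> real" where
  "node_avg A M h =
    avg M (\<lambda>t. \<Sum>x\<in>A. (h (arccos x - t) + h (arccos x + t)) * poly (lag A x) (cos t))"

lemma node_avg_sum: "node_avg A M (\<lambda>s. \<Sum>i\<in>I. f i s) = (\<Sum>i\<in>I. node_avg A M (f i))"
proof -
  have "node_avg A M (\<lambda>s. \<Sum>i\<in>I. f i s) = avg M (\<lambda>t. \<Sum>i\<in>I. \<Sum>x\<in>A. (f i (arccos x - t) + f i (arccos x + t)) * poly (lag A x) (cos t))"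
    unfolding node_avg_def by (subst sum.swap) (simp add: sum.distrib[symmetric] sum_distrib_right)
  then show ?thesis by (simp add: node_avg_def avg_sum)
qed

lemma node_avg_cmult: "node_avg A M (\<lambda>s. c * f s) = c * node_avg A M f"
proof -
  have "node_avg A M (\<lambda>s. c * f s) = avg M (\<lambda>t. c * (\<Sum>x\<in>A. (f (arccos x - t) + f (arccos x + t)) * poly (lag A x) (cos t)))"
    unfolding node_avg_def sum_distrib_left by (intro arg_cong[where f = "avg M"] ext sum.cong) (simp_all add: algebra_simps)
  then show ?thesis by (simp add: node_avg_def avg_cmult)
qed

lemma node_avg_diff: "node_avg A M (\<lambda>s. f s - g s) = node_avg A M f - node_avg A M g"
  unfolding node_avg_def avg_diff[symmetric] sum_subtractf[symmetric]
  by (intro arg_cong[where f = "avg M"] ext sum.cong) (simp_all add: algebra_simps)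

text \<open>The two translates add up to \<open>2 cos (k t)\<close> times the Chebyshev polynomial
  at the node. For \<open>k \<le> m\<close> interpolation reproduces that polynomial, leaving
  \<open>2 cos^2 (k t)\<close> with mean 1; for \<open>k > m\<close> the fundamental polynomials, of
  degree at most \<open>m\<close>, are orthogonal to \<open>cos (k t)\<close>.\<close>

lemma node_avg_cos:
  assumes "finite A" "A \<subseteq> {-1..1}" "card A = m + 1" "1 \<le> k" "2 * k < M" "k + m < M"
  shows "node_avg A M (\<lambda>s. cos (real k * s)) = (if k \<le> m then 1 else 0)"
proof -
  have eq: "cos (real k * (arccos x - t)) + cos (real k * (arccos x + t))
      = 2 * cos (real k * t) * poly (cheb k) x" if "x \<in> A" for x t
  proof -
    have "cos (real k * arccos x) = poly (cheb k) x"
      using that assms(2) poly_cheb_cos[of k "arccos x"] by force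
    then show ?thesis by (simp add: right_diff_distrib distrib_left cos_add cos_diff)
  qed
  have "node_avg A M (\<lambda>s. cos (real k * s)) =
    avg M (\<lambda>t. \<Sum>x\<in>A. (2 * poly (cheb k) x) * (cos (real k * t) * poly (lag A x) (cos t)))"
    unfolding node_avg_def by (intro arg_cong[where f = "avg M"] ext sum.cong) (simp_all add: eq)
  also have "\<dots> = (if k \<le> m then 1 else 0)"
  proof (cases "k \<le> m")
    case True
    have "(\<Sum>x\<in>A. (2 * poly (cheb k) x) * (cos (real k * t) * poly (lag A x) (cos t)))
       = 1 + cos (of_int (2 * int k) * t + 0)" for t
    proof -
      have "degree (cheb k) < card A" using degree_cheb[of k] True assms(3) by simp
      then have "cos (real k * t) = (\<Sum>x\<in>A. poly (cheb k) x * poly (lag A x) (cos t))"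
        using lagrange_interpolation[OF assms(1), of "cheb k" "cos t"] by (simp add: poly_cheb_cos)
      then have "(\<Sum>x\<in>A. (2 * poly (cheb k) x) * (cos (real k * t) * poly (lag A x) (cos t)))
         = 2 * cos (real k * t) * cos (real k * t)"
        by (simp add: sum_distrib_left mult_ac)
      also have "\<dots> = 1 + cos (2 * (real k * t))"
        unfolding cos_double_cos by (simp add: power2_eq_square)
      finally show ?thesis by (simp add: mult_ac)
    qed
    moreover have "avg M (\<lambda>t. cos (of_int (2 * int k) * t + 0)) = 0"
      using assms(4,5) by (subst avg_cos) auto
    ultimately show ?thesis using assms True by (simp only: avg_add avg_const) simp
  next
    case False
    have "avg M (\<lambda>t. cos (real k * t) * poly (lag A x) (cos t)) = 0" if "x \<in> A" for x
      using degree_lag[OF assms(1) that] False assms by (intro avg_cos_poly_cos) auto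
    then show ?thesis using False by (simp add: avg_sum avg_cmult)
  qed
  finally show ?thesis .
qed

lemma ln_le_avg_kern_lag:
  assumes A: "finite A" "A \<subseteq> {-1..1}" "card A = m + 1"
    and q: "1 \<le> q" "q \<le> N" "m = N + q" and M: "5 * m \<le> M"
  shows "ln (real (Suc N) / real q) \<le>
    6 * avg M (\<lambda>t. \<Sum>x\<in>A. kern q t (arccos x) * \<bar>poly (lag A x) (cos t)\<bar>)"
proof -
  \<comment> \<open>In Fejer's sum \<open>\<Sum>\<^sub>k (cos((m-k)s) - cos((m+k)s)) / k\<close> the partial sum of order \<open>m\<close> keeps the
    positive half only; the factor \<open>fejer q\<close> blurs the frequencies by less than \<open>q\<close>.\<close>
  define h where "h s = 2 * sin (real m * s) * (\<Sum>k=1..N. sin (real k * s) / real k) * fejer q s" for s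
  let ?I = "{1..N} \<times> {..<q} \<times> {..<q}"
  \<comment> \<open>The frequencies \<open>m - k + a - b\<close> and \<open>m + k + a - b\<close>,
    arranged so that truncated subtraction is exact.\<close>
  define u v where "u = (\<lambda>(k, a, b). (m + a) - (k + b))"
    and "v = (\<lambda>(k, a, b). (m + k + a) - b)"
  define w where "w = (\<lambda>(k, a :: nat, b :: nat). 1 / (real k * (real q)\<^sup>2))"
  have bounds: "1 \<le> u i" "2 * u i < M" "u i + m < M" "1 \<le> v i" "2 * v i < M" "v i + m < M" if "i \<in> ?I" for i
  proof -
    obtain k a b :: nat where "i = (k, a, b)" by (cases i)
    with that have i: "i = (k, a, b)" "1 \<le> k" "k \<le> N" "a < q" "b < q" by auto
    have "u i = (m + a) - (k + b)" "v i = (m + k + a) - b"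
      using i(1) by (simp_all add: u_def v_def)
    moreover have "k + b < m" "k + a < m" "5 * m \<le> M" "q \<le> m" "k < m" using i(2-5) q M by linarith+
    ultimately show "1 \<le> u i" "2 * u i < M" "u i + m < M" "1 \<le> v i" "2 * v i < M" "v i + m < M"
      using i(2-5) by linarith+
  qed
  have h_eq: "h s = (\<Sum>i\<in>?I. w i * (cos (real (u i) * s) - cos (real (v i) * s)))" for s
  proof -
    have expand: "2 * sin (real m * s) * (sin (real k * s) / real k) * fejer q s
      = (\<Sum>a<q. \<Sum>b<q. w (k, a, b) * (cos (real (u (k, a, b)) * s) - cos (real (v (k, a, b)) * s)))"
      if k: "k \<in> {1..N}" for k
    proof -
      let ?X = "\<lambda>l::int. \<Sum>a<q. \<Sum>b<q. cos (of_int (l + int a - int b) * s)"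
      have "2 * sin (real m * s) * sin (real k * s)
          = cos (of_int (int m - int k) * s + 0) - cos (of_int (int m + int k) * s + 0)"
        by (simp add: left_diff_distrib distrib_right cos_diff cos_add)
      then have "2 * sin (real m * s) * (sin (real k * s) / real k) * fejer q s =
        1 / real k * (cos (of_int (int m - int k) * s + 0) * fejer q s - cos (of_int (int m + int k) * s + 0) * fejer q s)"
        by (simp add: left_diff_distrib[symmetric])
      also have "\<dots> = 1 / real k * (?X (int m - int k) / (real q)\<^sup>2 - ?X (int m + int k) / (real q)\<^sup>2)"
        unfolding cos_mult_fejer by (simp only: add_0_right)
      also have "\<dots> = 1 / (real k * (real q)\<^sup>2) * (?X (int m - int k) - ?X (int m + int k))"
        by (simp only: diff_divide_distrib[symmetric] times_divide_eq_left mult_1_left divide_divide_eq_left mult.commute)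
      also have "\<dots> = (\<Sum>a<q. \<Sum>b<q. 1 / (real k * (real q)\<^sup>2) *
         (cos (of_int (int m - int k + int a - int b) * s) - cos (of_int (int m + int k + int a - int b) * s)))"
        by (simp only: sum_subtractf[symmetric] sum_distrib_left)
      also have "\<dots> = (\<Sum>a<q. \<Sum>b<q. w (k, a, b) * (cos (real (u (k, a, b)) * s) - cos (real (v (k, a, b)) * s)))"
      proof (intro sum.cong refl)
        fix a b assume ab: "a \<in> {..<q}" "b \<in> {..<q}"
        have "real (u (k, a, b)) = of_int (int m - int k + int a - int b)"
          "real (v (k, a, b)) = of_int (int m + int k + int a - int b)"
          using ab k q by (auto simp: u_def v_def of_nat_diff)
        then show "1 / (real k * (real q)\<^sup>2) * (cos (of_int (int m - int k + int a - int b) * s) - cos (of_int (int m + int k + int a - int b) * s))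
          = w (k, a, b) * (cos (real (u (k, a, b)) * s) - cos (real (v (k, a, b)) * s))"
          by (simp add: w_def)
      qed
      finally show ?thesis .
    qed
    have "h s = (\<Sum>k=1..N. 2 * sin (real m * s) * (sin (real k * s) / real k) * fejer q s)"
      by (simp add: h_def sum_distrib_left sum_distrib_right)
    also have "\<dots> = (\<Sum>k=1..N. \<Sum>a<q. \<Sum>b<q. w (k, a, b) * (cos (real (u (k, a, b)) * s) - cos (real (v (k, a, b)) * s)))"
      by (intro sum.cong refl expand)
    also have "\<dots> = (\<Sum>i\<in>?I. w i * (cos (real (u i) * s) - cos (real (v i) * s)))"
      by (simp add: sum.cartesian_product split_def)
    finally show ?thesis .
  qed
  have "node_avg A M h = (\<Sum>i\<in>?I. w i * (node_avg A M (\<lambda>s. cos (real (u i) * s)) - node_avg A M (\<lambda>s. cos (real (v i) * s))))"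
    unfolding h_eq[abs_def] by (simp only: node_avg_sum node_avg_cmult node_avg_diff)
  also have "\<dots> = (\<Sum>i\<in>?I. w i * ((if u i \<le> m then 1 else 0) - (if v i \<le> m then 1 else 0)))"
  proof (intro sum.cong refl)
    fix i assume i: "i \<in> ?I"
    show "w i * (node_avg A M (\<lambda>s. cos (real (u i) * s)) - node_avg A M (\<lambda>s. cos (real (v i) * s)))
      = w i * ((if u i \<le> m then 1 else 0) - (if v i \<le> m then 1 else 0))"
      using bounds[OF i] by (simp only: node_avg_cos[OF A])
  qed
  \<comment> \<open>For \<open>k \<ge> q\<close> the blur \<open>a - b\<close> cannot carry either
    frequency across \<open>m\<close>, so the bracket is 1. For \<open>k < q\<close> it is still
    nonnegative, since \<open>v i \<le> m\<close> implies \<open>u i \<le> m\<close>.\<close>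
  also have "\<dots> \<ge> (\<Sum>i\<in>?I. if q \<le> fst i then w i else 0)"
  proof (rule sum_mono)
    fix i assume "i \<in> ?I"
    then show "(if q \<le> fst i then w i else 0) \<le> w i * ((if u i \<le> m then 1 else 0) - (if v i \<le> m then 1 else 0))"
      by (auto simp: u_def v_def w_def)
  qed
  also have "(\<Sum>i\<in>?I. if q \<le> fst i then w i else 0) = (\<Sum>k=1..N. \<Sum>a<q. \<Sum>b<q. if q \<le> k then 1 / (real k * (real q)\<^sup>2) else 0)"
    unfolding sum.cartesian_product by (rule sum.cong) (auto simp: w_def)
  also have "\<dots> = (\<Sum>k=1..N. if q \<le> k then 1 / real k else 0)"
    using q by (intro sum.cong) (auto simp: power2_eq_square)
  also have "\<dots> = (\<Sum>k=q..N. 1 / real k)"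
    using q by (intro sum.mono_neutral_cong_right) auto
  finally have "ln (real (Suc N) / real q) \<le> node_avg A M h"
    using ln_le_sum_inverse[OF q(1,2)] by linarith
  also have "\<dots> \<le> avg M (\<lambda>t. 6 * (\<Sum>x\<in>A. kern q t (arccos x) * \<bar>poly (lag A x) (cos t)\<bar>))"
    unfolding node_avg_def
  proof (rule avg_mono)
    fix t
    have h: "\<bar>h s\<bar> \<le> 6 * fejer q s" for s
    proof -
      have "\<bar>2 * sin (real m * s)\<bar> * \<bar>\<Sum>k=1..N. sin (real k * s) / real k\<bar> \<le> 2 * 3"
        by (intro mult_mono abs_sum_sin_over_le) (auto simp: abs_mult)
      then show ?thesis using fejer_nonneg[of q s] unfolding h_def abs_mult by (simp add: mult_right_mono)
    qed
    have "(h (arccos x - t) + h (arccos x + t)) * poly (lag A x) (cos t)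
       \<le> 6 * (kern q t (arccos x) * \<bar>poly (lag A x) (cos t)\<bar>)" for x
    proof -
      have "\<bar>h (arccos x - t) + h (arccos x + t)\<bar> \<le> 6 * kern q t (arccos x)"
        using order_trans[OF abs_triangle_ineq add_mono[OF h h]] by (simp add: kern_def distrib_left)
      then have "\<bar>h (arccos x - t) + h (arccos x + t)\<bar> * \<bar>poly (lag A x) (cos t)\<bar>
         \<le> 6 * kern q t (arccos x) * \<bar>poly (lag A x) (cos t)\<bar>" by (rule mult_right_mono) simp
      then show ?thesis unfolding abs_mult[symmetric] mult.assoc by (rule order_trans[OF abs_ge_self])
    qed
    then show "(\<Sum>x\<in>A. (h (arccos x - t) + h (arccos x + t)) * poly (lag A x) (cos t))
      \<le> 6 * (\<Sum>x\<in>A. kern q t (arccos x) * \<bar>poly (lag A x) (cos t)\<bar>)"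
      unfolding sum_distrib_left by (rule sum_mono)
  qed
  finally show ?thesis by (simp only: avg_cmult)
qed

section \<open>Shattered node sets\<close>

text \<open>In the full sum at most two points lie within \<open>\<delta>\<close> of the centre,
  each with kernel value at most 2; this is the 4, and the tail with \<open>W = 1\<close> is the
  \<open>b\<close>.\<close>

lemma kern_sum_le:
  fixes Y :: "real set"
  assumes Y: "finite Y" "Y \<subseteq> {-1..1}" and \<delta>: "0 < \<delta>" and q: "0 < q" and W: "1 \<le> W" and \<tau>: "\<tau> \<in> {0..pi}"
    and sep: "\<And>u v. u \<in> Y \<Longrightarrow> v \<in> Y \<Longrightarrow> u \<noteq> v \<Longrightarrow> \<delta> \<le> \<bar>arccos u - arccos v\<bar>"
    and b: "128 / ((real q)\<^sup>2 * \<delta>\<^sup>2) \<le> b"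
  shows "(\<Sum>y | y \<in> Y \<and> real W * \<delta> \<le> \<bar>arccos y - \<tau>\<bar>. kern q \<tau> (arccos y)) \<le> b / real W"
    and "(\<Sum>y\<in>Y. kern q \<tau> (arccos y)) \<le> 4 + b"
proof -
  have arccos: "arccos y \<in> {0..pi}" if "y \<in> Y" for y
    using Y(2) that arccos_lbound[of y] arccos_ubound[of y] by auto
  have tail: "(\<Sum>y | y \<in> Y \<and> real V * \<delta> \<le> \<bar>arccos y - \<tau>\<bar>. kern q \<tau> (arccos y)) \<le> b / real V" if "1 \<le> V" for V
  proof -
    have "(\<Sum>y | y \<in> Y \<and> real V * \<delta> \<le> \<bar>arccos y - \<tau>\<bar>. kern q \<tau> (arccos y)) \<le> 128 / ((real q)\<^sup>2 * \<delta>\<^sup>2 * real V)"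
      by (rule kern_tail) (use Y \<delta> q \<tau> sep arccos that in auto)
    also have "\<dots> = 128 / ((real q)\<^sup>2 * \<delta>\<^sup>2) / real V" by simp
    also have "\<dots> \<le> b / real V" using b by (intro divide_right_mono) auto
    finally show ?thesis .
  qed
  show "(\<Sum>y | y \<in> Y \<and> real W * \<delta> \<le> \<bar>arccos y - \<tau>\<bar>. kern q \<tau> (arccos y)) \<le> b / real W"
    using tail[OF W] .
  let ?N = "{y \<in> Y. \<bar>arccos y - \<tau>\<bar> < real 1 * \<delta>}"
  have "card ?N \<le> 2 * 1"
    by (rule separated_two_sided(1)) (use Y \<delta> sep in auto)
  have "(\<Sum>y\<in>?N. kern q \<tau> (arccos y)) \<le> (\<Sum>y\<in>?N. 2)"
    by (intro sum_mono kern_le_2)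
  also have "\<dots> \<le> 4" using \<open>card ?N \<le> 2 * 1\<close> by simp
  finally have near: "(\<Sum>y\<in>?N. kern q \<tau> (arccos y)) \<le> 4" .
  have "Y = ?N \<union> {y. y \<in> Y \<and> real 1 * \<delta> \<le> \<bar>arccos y - \<tau>\<bar>}" by auto
  then have "(\<Sum>y\<in>Y. kern q \<tau> (arccos y)) = (\<Sum>y\<in>?N. kern q \<tau> (arccos y))
      + (\<Sum>y | y \<in> Y \<and> real 1 * \<delta> \<le> \<bar>arccos y - \<tau>\<bar>. kern q \<tau> (arccos y))"
    by (subst sum.union_disjoint[symmetric]) (use Y in auto)
  then show "(\<Sum>y\<in>Y. kern q \<tau> (arccos y)) \<le> 4 + b"
    using near tail[of 1] by simp
qed

lemma bernstein_arccos:
  fixes p :: "real poly"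
  assumes "degree p \<le> m" "\<And>x. x \<in> {-1..1} \<Longrightarrow> \<bar>poly p x\<bar> \<le> K" "u \<in> {-1..1}" "v \<in> {-1..1}"
  shows "\<bar>poly p u - poly p v\<bar> \<le> 2 * real m * K * \<bar>arccos u - arccos v\<bar>"
  using bernstein[OF assms(1,2), of "arccos u" "arccos v"] assms(3,4) by simp

text \<open>Shattering in normalized form: after division by \<open>1 - \<rho>\<close> the margin at
  the prescribed signs is 1 and the norm bound is \<open>K = C / (1 - \<rho>)\<close>.\<close>

definition realizable :: "nat \<Rightarrow> real \<Rightarrow> real set \<Rightarrow> bool" where
  "realizable m K S \<longleftrightarrow> (\<forall>\<sigma>. (\<forall>x. \<sigma> x \<in> {-1, 1::real}) \<longrightarrow>
    (\<exists>p. degree p \<le> m \<and> (\<forall>x\<in>{-1..1}. \<bar>poly p x\<bar> \<le> K) \<and> (\<forall>x\<in>S. 1 \<le> \<sigma> x * poly p x)))"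

lemma realizableE:
  assumes "realizable m K S" "\<And>x. \<sigma> x \<in> {-1, 1::real}"
  obtains p where "degree p \<le> m" "\<And>x. x \<in> {-1..1} \<Longrightarrow> \<bar>poly p x\<bar> \<le> K"
    "\<And>x. x \<in> S \<Longrightarrow> 1 \<le> \<sigma> x * poly p x"
  using assms unfolding realizable_def by blast

text \<open>Opposite signs at \<open>u\<close> and \<open>v\<close> force an increment of at least
  2, which Bernstein's inequality makes impossible for too close angles.\<close>

lemma realizable_separated:
  assumes "realizable m K {u, v}" "u \<noteq> v" "u \<in> {-1..1}" "v \<in> {-1..1}"
  shows "1 \<le> real m * K * \<bar>arccos u - arccos v\<bar>"
proof -
  obtain p where p: "degree p \<le> m" "\<And>x. x \<in> {-1..1} \<Longrightarrow> \<bar>poly p x\<bar> \<le> K"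
      "\<And>x. x \<in> {u, v} \<Longrightarrow> 1 \<le> (if x = u then 1 else -1) * poly p x"
    by (rule realizableE[OF assms(1), of "\<lambda>x. if x = u then 1 else -1"]) auto
  have "1 \<le> poly p u" "1 \<le> - poly p v" using p(3)[of u] p(3)[of v] assms(2) by auto
  then have "2 \<le> \<bar>poly p u - poly p v\<bar>" by linarith
  also have "\<dots> \<le> 2 * real m * K * \<bar>arccos u - arccos v\<bar>"
    by (rule bernstein_arccos[OF p(1,2) assms(3,4)])
  finally show ?thesis by simp
qed

text \<open>Let \<open>p\<close> realize on \<open>S\<close> the signs of the fundamental
  polynomials at \<open>s\<close>, and interpolate \<open>p * k\<close>, where \<open>k\<close> is
  the kernel as a polynomial; the degree is below \<open>m + q\<close>. The terms over
  \<open>S\<close> are then all nonnegative and dominate the left side. The value at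
  \<open>s\<close>, the other nodes of \<open>X\<close> and the points of \<open>Z\<close> give the
  three summands on the right.\<close>

lemma weighted_lag_le:
  assumes X: "finite X" "X \<subseteq> {-1..1}" and Z: "finite Z" "Z \<subseteq> {-1..1}" "X \<inter> Z = {}"
    and card: "card X + card Z = m + q + 1" and q: "0 < q"
    and lagZ: "\<And>z x. z \<in> Z \<Longrightarrow> x \<in> {-1..1} \<Longrightarrow> \<bar>poly (lag (X \<union> Z) z) x\<bar> \<le> 2"
    and S: "S \<subseteq> X" "realizable m K S" and s: "s \<in> {-1..1}"
  shows "(\<Sum>x\<in>S. kern q \<tau> (arccos x) * \<bar>poly (lag (X \<union> Z) x) s\<bar>) \<le>
    2 * K + K * (\<Sum>x\<in>X - S. kern q \<tau> (arccos x) * \<bar>poly (lag (X \<union> Z) x) s\<bar>)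
    + 2 * K * (\<Sum>z\<in>Z. kern q \<tau> (arccos z))"
proof -
  let ?U = "\<lambda>x. poly (lag (X \<union> Z) x) s" and ?J = "\<lambda>x. kern q \<tau> (arccos x)"
  define \<sigma> :: "real \<Rightarrow> real" where "\<sigma> x = (if 0 \<le> ?U x then 1 else -1)" for x
  obtain p where p: "degree p \<le> m" "\<And>x. x \<in> {-1..1} \<Longrightarrow> \<bar>poly p x\<bar> \<le> K"
      "\<And>x. x \<in> S \<Longrightarrow> 1 \<le> \<sigma> x * poly p x"
    by (rule realizableE[OF S(2), of \<sigma>]) (auto simp: \<sigma>_def)
  obtain k where k: "degree k < q" "\<And>\<theta>. poly k (cos \<theta>) = kern q \<tau> \<theta>"
    using kern_poly[OF q, of \<tau>] by auto
  have kJ: "poly k x = ?J x" if "x \<in> {-1..1}" for x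
    using k(2)[of "arccos x"] that by simp
  have fin: "finite (X \<union> Z)" "finite S" using X Z S finite_subset by auto
  have "degree (p * k) < card (X \<union> Z)"
    using degree_mult_le[of p k] p(1) k(1) card X(1) Z(1,3) by (simp add: card_Un_disjoint)
  then have "poly (p * k) s = (\<Sum>x\<in>X \<union> Z. poly (p * k) x * ?U x)"
    by (rule lagrange_interpolation[OF fin(1)])
  also have "\<dots> = (\<Sum>x\<in>X \<union> Z. poly p x * ?J x * ?U x)"
    using X Z by (intro sum.cong) (auto simp: kJ)
  also have "\<dots> = (\<Sum>x\<in>S. poly p x * ?J x * ?U x) + (\<Sum>x\<in>X - S. poly p x * ?J x * ?U x)
      + (\<Sum>z\<in>Z. poly p z * ?J z * ?U z)"
    using X Z S by (simp add: sum.union_disjoint sum.subset_diff[of S X])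
  finally have eq: "(\<Sum>x\<in>S. poly p x * ?J x * ?U x) = poly (p * k) s
     - (\<Sum>x\<in>X - S. poly p x * ?J x * ?U x) - (\<Sum>z\<in>Z. poly p z * ?J z * ?U z)" by simp
  have "(\<Sum>x\<in>S. ?J x * \<bar>?U x\<bar>) \<le> (\<Sum>x\<in>S. poly p x * ?J x * ?U x)"
  proof (rule sum_mono)
    fix x assume "x \<in> S"
    have "1 * (?J x * \<bar>?U x\<bar>) \<le> (\<sigma> x * poly p x) * (?J x * \<bar>?U x\<bar>)"
      using p(3)[OF \<open>x \<in> S\<close>] kern_nonneg by (intro mult_right_mono) auto
    also have "\<dots> = poly p x * ?J x * ?U x" by (auto simp: \<sigma>_def)
    finally show "?J x * \<bar>?U x\<bar> \<le> poly p x * ?J x * ?U x" by simp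
  qed
  moreover have "poly (p * k) s \<le> 2 * K"
  proof -
    have "\<bar>poly p s\<bar> * \<bar>poly k s\<bar> \<le> K * 2"
      using kern_le_2[of q \<tau> "arccos s"] kern_nonneg[of q \<tau> "arccos s"] p(2)[OF s]
      by (intro mult_mono) (auto simp: kJ[OF s])
    then show ?thesis by (simp add: abs_mult[symmetric])
  qed
  moreover have "- (\<Sum>x\<in>X - S. poly p x * ?J x * ?U x) \<le> K * (\<Sum>x\<in>X - S. ?J x * \<bar>?U x\<bar>)"
    unfolding sum_negf[symmetric] sum_distrib_left
  proof (rule sum_mono)
    fix x assume "x \<in> X - S"
    then have "\<bar>poly p x\<bar> * (?J x * \<bar>?U x\<bar>) \<le> K * (?J x * \<bar>?U x\<bar>)"
      using p(2)[of x] X kern_nonneg by (intro mult_right_mono) auto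
    then show "- (poly p x * ?J x * ?U x) \<le> K * (?J x * \<bar>?U x\<bar>)"
      using abs_ge_minus_self[of "poly p x * ?J x * ?U x"] kern_nonneg[of q \<tau> "arccos x"]
      by (simp add: abs_mult mult.assoc)
  qed
  moreover have "- (\<Sum>z\<in>Z. poly p z * ?J z * ?U z) \<le> 2 * K * (\<Sum>z\<in>Z. ?J z)"
    unfolding sum_negf[symmetric] sum_distrib_left
  proof (rule sum_mono)
    fix z assume z: "z \<in> Z"
    then have "\<bar>poly p z\<bar> * \<bar>?U z\<bar> * ?J z \<le> (K * 2) * ?J z"
      using p(2)[of z] lagZ[OF z s] Z kern_nonneg by (intro mult_right_mono mult_mono) auto
    then show "- (poly p z * ?J z * ?U z) \<le> 2 * K * ?J z"
      using abs_ge_minus_self[of "poly p z * ?J z * ?U z"] kern_nonneg[of q \<tau> "arccos z"]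
      by (simp add: abs_mult mult_ac)
  qed
  ultimately show ?thesis using eq by linarith
qed

text \<open>Here \<open>X\<close> is the set of surviving nodes and \<open>m + q\<close> the
  interpolation degree. The fundamental polynomials of \<open>X\<close> are bounded in two passes: a
  crude pointwise bound makes the far nodes negligible, and then the kernel-weighted sum is bounded
  linearly in \<open>K\<close> before averaging.\<close>

lemma ln_le_of_realizable:
  fixes X :: "real set" and n m q R W :: nat and K B :: real
  assumes X: "finite X" "X \<subseteq> {-1..1}"
    and realX: "\<And>S. S \<subseteq> X \<Longrightarrow> card S \<le> 2 * W \<Longrightarrow> realizable m K S"
    and n: "0 < n" "n \<le> m" "m \<le> 2 * n"
    and q: "0 < q" "q * R \<le> n" "n \<le> 2 * (q * R)"
    and K: "0 < K" "1 + K \<le> real R"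
    and B: "B = 100000 * real R ^ 4" and W: "real W = 12 * (real R)\<^sup>2 * B\<^sup>2"
    and cardX: "card X \<le> m + q + 1" "m + q + 1 \<le> card X + 3 * q"
  shows "ln (real R) \<le> 84 * (1 + K)"
proof -
  have R: "1 < real R" using K by linarith
  then have R1: "1 \<le> R" by simp
  have Bpos: "1 \<le> real R ^ 4" "100000 \<le> B" using R unfolding B by simp_all
  have Wpos: "0 < real W" using W R Bpos by simp
  then have W1: "1 \<le> W" by simp
  have qn: "q \<le> n" using q(2) R1 by (metis le_trans mult_le_mono2 mult.right_neutral)
  define d where "d = m + q + 1 - card X"
  have d: "card X + d = m + q + 1" "d \<le> 3 * q" using cardX by (auto simp: d_def)
  obtain Z where Z: "finite Z" "card Z = d" "Z \<subseteq> {-1..1}" "X \<inter> Z = {}"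
      and lagZ: "\<And>z x. z \<in> Z \<Longrightarrow> x \<in> {-1..1} \<Longrightarrow> \<bar>poly (lag (X \<union> Z) z) x\<bar> \<le> 2"
    using exists_near_fekete[OF X, of d] by blast
  let ?A = "X \<union> Z"
  have A: "finite ?A" "?A \<subseteq> {-1..1}" "card ?A = (m + q) + 1"
    using X Z d by (auto simp: card_Un_disjoint)
  \<comment> \<open>One separation serves both sets: \<open>X\<close> is separated by
    \<open>1 / (m * K)\<close> and \<open>Z\<close> by \<open>1 / (4 * (m + q))\<close>, where
    \<open>m + q \<le> 3 * n\<close> and \<open>K \<le> R\<close>.\<close>
  define \<delta> where "\<delta> = 1 / (12 * real n * real R)"
  have \<delta>: "0 < \<delta>" using n R by (simp add: \<delta>_def)
  have \<delta>_le: "\<delta> \<le> D" if "1 \<le> 12 * real n * real R * D" for D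
    using that n R by (simp add: \<delta>_def divide_le_eq mult.commute)
  \<comment> \<open>Since \<open>n \<le> 2 * q * R\<close>, the quantity
    \<open>1 / (q * \<delta>)\<close> is at most \<open>24 * R^2\<close>, so the left side is at
    most \<open>73728 * R^4\<close>.\<close>
  have bB: "128 / ((real q)\<^sup>2 * \<delta>\<^sup>2) \<le> B"
  proof -
    have "real n \<le> 2 * (real q * real R)" using q(3) by (metis of_nat_le_iff of_nat_mult of_nat_numeral)
    then have "(real n)\<^sup>2 \<le> (2 * (real q * real R))\<^sup>2" by (intro power_mono) auto
    then have "18432 * (real R)\<^sup>2 * (real n)\<^sup>2 \<le> 18432 * (real R)\<^sup>2 * (2 * (real q * real R))\<^sup>2"
      by (intro mult_left_mono) auto
    also have "\<dots> = 73728 * real R ^ 4 * (real q)\<^sup>2"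
      by (simp add: power_mult_distrib power2_eq_square power4_eq_xxxx)
    also have "\<dots> \<le> B * (real q)\<^sup>2"
      unfolding B by (intro mult_right_mono) auto
    finally have "18432 * (real R)\<^sup>2 * (real n)\<^sup>2 / (real q)\<^sup>2 \<le> B"
      using q(1) by (simp add: divide_le_eq)
    moreover have "128 / ((real q)\<^sup>2 * \<delta>\<^sup>2) = 18432 * (real R)\<^sup>2 * (real n)\<^sup>2 / (real q)\<^sup>2"
      using n R by (simp add: \<delta>_def power_divide power_mult_distrib mult_ac)
    ultimately show ?thesis by simp
  qed
  have sepX: "\<delta> \<le> \<bar>arccos u - arccos v\<bar>" if "u \<in> X" "v \<in> X" "u \<noteq> v" for u v
  proof (rule \<delta>_le)
    have "realizable m K {u, v}" using that W1 by (intro realX) auto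
    then have "1 \<le> real m * K * \<bar>arccos u - arccos v\<bar>"
      using that X by (intro realizable_separated) auto
    also have "\<dots> \<le> (12 * real n) * real R * \<bar>arccos u - arccos v\<bar>"
      using n K by (intro mult_mono) auto
    finally show "1 \<le> 12 * real n * real R * \<bar>arccos u - arccos v\<bar>" .
  qed
  \<comment> \<open>The fundamental polynomial of \<open>u\<close> drops from 1 at \<open>u\<close>
    to 0 at \<open>v\<close> while bounded by 2, so Bernstein's inequality separates
    \<open>Z\<close> without any realizability.\<close>
  have sepZ: "\<delta> \<le> \<bar>arccos u - arccos v\<bar>" if "u \<in> Z" "v \<in> Z" "u \<noteq> v" for u v
  proof (rule \<delta>_le)
    have "degree (lag ?A u) \<le> m + q" using degree_lag[of ?A u] A that by simp
    then have "\<bar>poly (lag ?A u) u - poly (lag ?A u) v\<bar> \<le> 2 * real (m + q) * 2 * \<bar>arccos u - arccos v\<bar>"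
      using that Z lagZ by (intro bernstein_arccos) auto
    moreover have "\<bar>poly (lag ?A u) u - poly (lag ?A u) v\<bar> = 1"
      using that A by (simp add: poly_lag_node)
    ultimately have "1 \<le> 2 * real (m + q) * 2 * \<bar>arccos u - arccos v\<bar>" by simp
    also have "\<dots> \<le> (12 * real n) * real R * \<bar>arccos u - arccos v\<bar>"
    proof (rule mult_right_mono)
      have "2 * real (m + q) * 2 \<le> 12 * real n * 1" using n qn by simp
      also have "\<dots> \<le> 12 * real n * real R" using R by (intro mult_left_mono) auto
      finally show "2 * real (m + q) * 2 \<le> 12 * real n * real R" .
    qed simp
    finally show "1 \<le> 12 * real n * real R * \<bar>arccos u - arccos v\<bar>" .
  qed
  define U where "U x s = \<bar>poly (lag ?A x) s\<bar>" for x s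
  have U0: "0 \<le> U x s" for x s by (simp add: U_def)
  \<comment> \<open>Separation leaves at most \<open>2 * W\<close> nodes in this window, so its sign
    patterns are realizable.\<close>
  define near where "near \<tau> = {x \<in> X. \<bar>arccos x - \<tau>\<bar> < real W * \<delta>}" for \<tau>
  have near_sub: "near \<tau> \<subseteq> X" for \<tau> by (auto simp: near_def)
  have minus_near: "X - near \<tau> = {x. x \<in> X \<and> real W * \<delta> \<le> \<bar>arccos x - \<tau>\<bar>}" for \<tau>
    by (auto simp: near_def)
  have near: "(\<Sum>x\<in>near \<tau>. kern q \<tau> (arccos x) * U x s) \<le>
      2 * K + K * (\<Sum>x\<in>X - near \<tau>. kern q \<tau> (arccos x) * U x s)
      + 2 * K * (\<Sum>z\<in>Z. kern q \<tau> (arccos z))" if "s \<in> {-1..1}" for s \<tau>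
    unfolding U_def
  proof (rule weighted_lag_le[OF X Z(1,3,4) _ q(1) lagZ near_sub _ that])
    show "card X + card Z = m + q + 1" using d Z by simp
    have "card (near \<tau>) \<le> 2 * W"
      unfolding near_def by (rule separated_two_sided(1)) (use X \<delta> sepX in auto)
    then show "realizable m K (near \<tau>)" by (intro realX near_sub)
  qed
  have far: "(\<Sum>x\<in>X - near \<tau>. kern q \<tau> (arccos x) * U x s) \<le> a * (B / real W)"
    if "\<tau> \<in> {0..pi}" "\<And>x. x \<in> X \<Longrightarrow> U x s \<le> a" "0 \<le> a" for \<tau> s a
  proof -
    have "(\<Sum>x\<in>X - near \<tau>. kern q \<tau> (arccos x) * U x s) \<le> (\<Sum>x\<in>X - near \<tau>. kern q \<tau> (arccos x) * a)"
      using that by (intro sum_mono mult_left_mono kern_nonneg) auto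
    also have "\<dots> = a * (\<Sum>x\<in>X - near \<tau>. kern q \<tau> (arccos x))"
      by (simp add: sum_distrib_left mult.commute)
    also have "\<dots> \<le> a * (B / real W)"
      unfolding minus_near
      by (intro mult_left_mono kern_sum_le(1)[OF X \<delta> q(1) W1 that(1) sepX bB] that(3))
    finally show ?thesis .
  qed
  have sumZ: "(\<Sum>z\<in>Z. kern q \<tau> (arccos z)) \<le> 2 * B" if "\<tau> \<in> {0..pi}" for \<tau>
    using kern_sum_le(2)[OF Z(1,3) \<delta> q(1) W1 that sepZ bB] Bpos by linarith
  \<comment> \<open>This fixes \<open>W\<close>: the crude bound \<open>12 * R * B\<close> times the
    kernel tail \<open>B / W\<close> must be as small as \<open>1 / R\<close>, to absorb the factor
    \<open>1 + K \<le> R\<close> later.\<close>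
  have KBW: "12 * real R * B * (B / real W) = 1 / real R" "K * (B / real W) \<le> 1 / 2"
  proof -
    show eq: "12 * real R * B * (B / real W) = 1 / real R"
      using R Bpos unfolding W by (simp add: power2_eq_square)
    have "K * (B / real W) \<le> real R * (B / real W)"
      using K Bpos Wpos by (intro mult_right_mono) auto
    also have "\<dots> = 1 / real R / (12 * B)"
      unfolding eq[symmetric] using Bpos by simp
    also have "\<dots> \<le> 1 / 2"
    proof -
      have "2 * 1 \<le> (12 * B) * real R" using Bpos R by (intro mult_mono) auto
      then show ?thesis using Bpos R by (simp add: field_simps)
    qed
    finally show "K * (B / real W) \<le> 1 / 2" .
  qed
  have U_le: "U x s \<le> 12 * real R * B" if "x \<in> X" and s: "s \<in> {-1..1}" for x s
  proof -
    have "X \<noteq> {}" using that(1) by blast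
    then obtain y where y: "y \<in> X" and Max: "Max ((\<lambda>x. U x s) ` X) = U y s"
      using obtains_MAX[OF X(1), of "\<lambda>x. U x s"] by blast
    have max: "U x s \<le> U y s" if "x \<in> X" for x
      using that X(1) Max_ge[of "(\<lambda>x. U x s) ` X" "U x s"] unfolding Max by simp
    note y = y max
    \<comment> \<open>Centring the kernel at the node of the largest fundamental polynomial lets the far part be absorbed.\<close>
    define \<tau> where "\<tau> = arccos y"
    have \<tau>: "\<tau> \<in> {0..pi}" using y(1) X arccos_lbound[of y] arccos_ubound[of y] by (auto simp: \<tau>_def)
    have "y \<in> near \<tau>" using y(1) Wpos \<delta> by (simp add: near_def \<tau>_def)
    have "1 * U y s \<le> kern q \<tau> (arccos y) * U y s"
      using kern_self[OF q(1), of \<tau>] U0 unfolding \<tau>_def by (intro mult_right_mono) auto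
    also have "\<dots> \<le> (\<Sum>x\<in>near \<tau>. kern q \<tau> (arccos x) * U x s)"
      using \<open>y \<in> near \<tau>\<close> finite_subset[OF near_sub X(1)] kern_nonneg U0
      by (intro member_le_sum) auto
    also have "\<dots> \<le> 2 * K + K * (U y s * (B / real W)) + 2 * K * (2 * B)"
      using near[OF s, of \<tau>] K mult_left_mono[OF far[OF \<tau> y(2) U0], of K]
        mult_left_mono[OF sumZ[OF \<tau>], of "2 * K"] by linarith
    also have "K * (U y s * (B / real W)) \<le> 1 / 2 * U y s"
      using mult_right_mono[OF KBW(2) U0[of y s]] by (simp add: mult_ac)
    finally have "U y s \<le> 4 * K + 8 * (K * B)" by simp
    also have "\<dots> \<le> 12 * (K * B)" using Bpos K by simp
    also have "\<dots> \<le> 12 * (real R * B)" using Bpos K by (intro mult_left_mono mult_right_mono) auto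
    finally show ?thesis using y(2)[OF that(1)] by simp
  qed
  define \<Phi> where "\<Phi> t = (\<Sum>x\<in>X. kern q t (arccos x) * U x (cos t))" for t
  define \<Psi> where "\<Psi> t = (\<Sum>z\<in>Z. kern q t (arccos z))" for t
  \<comment> \<open>Second pass: the far sum occurs once in \<open>\<Phi> t\<close> itself and
    \<open>K\<close> times in the bound for the near part, and
    \<open>(1 + K) / R \<le> 1\<close>.\<close>
  have \<Phi>_le: "\<Phi> t \<le> (2 * K + 1) + 2 * K * \<Psi> t" for t
  proof -
    define \<tau> where "\<tau> = arccos (cos t)"
    have \<tau>: "\<tau> \<in> {0..pi}" by (auto simp: \<tau>_def arccos_lbound arccos_ubound)
    have s: "cos t \<in> {-1..1}" by simp
    have kern: "kern q t = kern q \<tau>" by (simp add: \<tau>_def kern_arccos fun_eq_iff)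
    let ?F = "\<Sum>x\<in>X - near \<tau>. kern q \<tau> (arccos x) * U x (cos t)"
    have "\<Phi> t = (\<Sum>x\<in>near \<tau>. kern q \<tau> (arccos x) * U x (cos t)) + ?F"
      unfolding \<Phi>_def kern using sum.subset_diff[OF near_sub X(1)] by (simp add: add.commute)
    also have "\<dots> \<le> 2 * K + (1 + K) * ?F + 2 * K * \<Psi> t"
      using near[OF s, of \<tau>] by (simp add: \<Psi>_def kern distrib_right)
    also have "(1 + K) * ?F \<le> real R * (1 / real R)"
    proof (rule mult_mono)
      show "?F \<le> 1 / real R"
        using far[OF \<tau>, of "cos t" "12 * real R * B"] U_le[OF _ s] Bpos KBW(1) by simp
      show "0 \<le> ?F" by (intro sum_nonneg mult_nonneg_nonneg kern_nonneg U0)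
    qed (use K in auto)
    finally show ?thesis using R by simp
  qed
  define M where "M = 5 * (m + q)"
  \<comment> \<open>Averaging is essential here: pointwise \<open>\<Psi>\<close> is only controlled
    by \<open>2 * B\<close>, a power of \<open>R\<close>, but each of the at most
    \<open>3 * q\<close> kernels has mean \<open>2 / q\<close>.\<close>
  have avg\<Psi>: "avg M \<Psi> \<le> 6"
  proof -
    have "avg M \<Psi> = real d * (2 / real q)"
      unfolding \<Psi>_def avg_sum using Z q(1) by (simp add: avg_kern M_def)
    also have "\<dots> \<le> real (3 * q) * (2 / real q)"
      using d(2) by (intro mult_right_mono) (auto simp del: of_nat_mult)
    finally show ?thesis using q(1) by simp
  qed
  \<comment> \<open>The lower bound is used with \<open>N = m\<close>, the interpolation degree
    being \<open>m + q\<close>.\<close>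
  have "ln (real R) \<le> ln (real (Suc m) / real q)"
  proof -
    have "real R * real q \<le> real n" using q(2) by (metis mult.commute of_nat_le_iff of_nat_mult)
    then have "real R \<le> real (Suc m) / real q" using q(1) n by (simp add: le_divide_eq)
    then show ?thesis using R by simp
  qed
  also have "\<dots> \<le> 6 * avg M (\<lambda>t. \<Sum>x\<in>?A. kern q t (arccos x) * \<bar>poly (lag ?A x) (cos t)\<bar>)"
    by (rule ln_le_avg_kern_lag[OF A]) (use q(1) qn n in \<open>auto simp: M_def\<close>)
  also have "\<dots> \<le> 6 * avg M (\<lambda>t. (2 * K + 1) + (2 * K + 2) * \<Psi> t)"
  proof (intro mult_left_mono avg_mono)
    fix t
    have "(\<Sum>x\<in>?A. kern q t (arccos x) * \<bar>poly (lag ?A x) (cos t)\<bar>)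
      = \<Phi> t + (\<Sum>z\<in>Z. kern q t (arccos z) * \<bar>poly (lag ?A z) (cos t)\<bar>)"
      using X Z by (simp add: sum.union_disjoint \<Phi>_def U_def)
    also have "(\<Sum>z\<in>Z. kern q t (arccos z) * \<bar>poly (lag ?A z) (cos t)\<bar>) \<le> (\<Sum>z\<in>Z. kern q t (arccos z) * 2)"
      using lagZ by (intro sum_mono mult_left_mono kern_nonneg) auto
    also have "\<dots> = 2 * \<Psi> t" by (simp add: \<Psi>_def sum_distrib_left mult.commute)
    finally show "(\<Sum>x\<in>?A. kern q t (arccos x) * \<bar>poly (lag ?A x) (cos t)\<bar>)
      \<le> (2 * K + 1) + (2 * K + 2) * \<Psi> t"
      using \<Phi>_le[of t] by (simp add: distrib_right)
  qed simp
  also have "\<dots> = 6 * ((2 * K + 1) + (2 * K + 2) * avg M \<Psi>)"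
    using n by (simp add: avg_add avg_cmult avg_const M_def)
  \<comment> \<open>The result is \<open>84 * K + 78\<close>.\<close>
  also have "\<dots> \<le> 6 * ((2 * K + 1) + (2 * K + 2) * 6)"
    using K by (intro mult_left_mono add_left_mono avg\<Psi>) auto
  finally show ?thesis using K by simp
qed

section \<open>Gluing sign patterns\<close>

text \<open>Sets carrying an unrealizable pattern are removed one after another. Being disjoint,
  they can all keep their patterns in \<open>y\<close>, and each forces an error on every member of
  \<open>G\<close>; thus \<open>f\<close> forced errors cost at most \<open>w * f\<close>
  indices.\<close>

lemma glue_sign_patterns:
  fixes ok :: "'p \<Rightarrow> 'i \<Rightarrow> real \<Rightarrow> bool"
  assumes "finite I" "G \<noteq> {}"
  shows "\<exists>X f y. X \<subseteq> I \<and> card I \<le> card X + w * f \<and> y \<in> I \<rightarrow> {-1, 1} \<and>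
    (\<forall>P\<in>G. f \<le> card {i \<in> I. \<not> ok P i (y i)}) \<and>
    (\<forall>S\<subseteq>X. card S \<le> w \<longrightarrow> (\<forall>\<sigma>. (\<forall>i. \<sigma> i \<in> {-1, 1}) \<longrightarrow> (\<exists>P\<in>G. \<forall>i\<in>S. ok P i (\<sigma> i))))"
proof -
  define shattered where "shattered X \<longleftrightarrow> (\<forall>S\<subseteq>X. card S \<le> w \<longrightarrow>
      (\<forall>\<sigma>. (\<forall>i. \<sigma> i \<in> {-1, 1}) \<longrightarrow> (\<exists>P\<in>G. \<forall>i\<in>S. ok P i (\<sigma> i))))" for X
  have "\<exists>X f y. X \<subseteq> I \<and> card I \<le> card X + w * f \<and> y \<in> I \<rightarrow> {-1, 1} \<and>
    (\<forall>P\<in>G. f \<le> card {i \<in> I. \<not> ok P i (y i)}) \<and> shattered X"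
    using assms(1)
  proof (induction I rule: finite_psubset_induct)
    case (psubset I)
    show ?case
    proof (cases "shattered I")
      case True
      have "(\<lambda>_. 1) \<in> I \<rightarrow> {-1, 1::real}" by simp
      with True show ?thesis by (intro exI[of _ I] exI[of _ 0] exI[of _ "\<lambda>_. 1"]) simp
    next
      case False
      then obtain S \<sigma> where S: "S \<subseteq> I" "card S \<le> w" "\<forall>i. \<sigma> i \<in> {-1, 1}"
          and bad: "\<And>P. P \<in> G \<Longrightarrow> \<exists>i\<in>S. \<not> ok P i (\<sigma> i)"
        unfolding shattered_def by meson
      \<comment> \<open>Nonemptiness of \<open>G\<close> enters here: an empty \<open>S\<close>
        would be realized vacuously, so the removal is proper and the induction applies.\<close>
      have "S \<noteq> {}" using bad assms(2) by fastforce
      then have "I - S \<subset> I" using S(1) by blast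
      from psubset.IH[OF this] obtain X f y where "X \<subseteq> I - S \<and> card (I - S) \<le> card X + w * f
          \<and> y \<in> (I - S) \<rightarrow> {-1, 1} \<and> (\<forall>P\<in>G. f \<le> card {i \<in> I - S. \<not> ok P i (y i)}) \<and> shattered X"
        by (elim exE) (rule that)
      then have X: "X \<subseteq> I - S" "card (I - S) \<le> card X + w * f"
        and y: "y \<in> (I - S) \<rightarrow> {-1, 1}" "\<And>P. P \<in> G \<Longrightarrow> f \<le> card {i \<in> I - S. \<not> ok P i (y i)}"
        and good: "shattered X"
        by simp_all
      let ?y = "\<lambda>i. if i \<in> S then \<sigma> i else y i"
      have finS: "finite S" using S(1) psubset.hyps finite_subset by blast
      have "Suc f \<le> card {i \<in> I. \<not> ok P i (?y i)}" if P: "P \<in> G" for P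
      proof -
        obtain i where i: "i \<in> S" "\<not> ok P i (\<sigma> i)" using bad[OF P] by blast
        have "Suc f \<le> card (insert i {i \<in> I - S. \<not> ok P i (y i)})"
          using y(2)[OF P] i(1) psubset.hyps by simp
        also have "\<dots> \<le> card {i \<in> I. \<not> ok P i (?y i)}"
          using i S(1) psubset.hyps by (intro card_mono) auto
        finally show ?thesis .
      qed
      moreover have "card I \<le> card X + w * Suc f"
        using X(2) S(1,2) finS psubset.hyps by (simp add: card_Diff_subset)
      moreover have "?y \<in> I \<rightarrow> {-1, 1}" using y(1) S(3) by (simp add: Pi_iff)
      moreover have "X \<subseteq> I" using X(1) by blast
      ultimately show ?thesis using good by blast
    qed
  qed
  then show ?thesis unfolding shattered_def .
qed

section \<open>From the complex polynomial class to real realizability\<close>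

lemma poly_map_poly_Re: "poly (map_poly Re P) x = Re (poly P (of_real x))"
  by (induction P) (simp_all add: map_poly_pCons)

lemma cmod_poly_le_unit_norm: "t \<in> {-1..1} \<Longrightarrow> cmod (poly P (of_real t)) \<le> unit_norm P"
  using unit_norm_is_max[of P] by auto

text \<open>The real part, divided by \<open>1 - \<rho>\<close>, inherits degree and norm bounds,
  and distance at most \<open>\<rho>\<close> from a sign leaves margin \<open>1 - \<rho>\<close>. A
  pattern on node values is pulled back to indices along \<open>x\<close>.\<close>

lemma realizable_of_poly_class:
  assumes \<rho>: "\<rho> < 1" and C: "0 < C" and D: "0 \<le> D"
    and pat: "\<And>\<sigma>. (\<And>i. \<sigma> i \<in> {-1, 1}) \<Longrightarrow>
      \<exists>P\<in>poly_class D C. \<forall>i\<in>T. cmod (poly P (of_real (x i)) - of_real (\<sigma> i)) \<le> \<rho>"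
  shows "realizable (nat \<lfloor>D\<rfloor>) (C / (1 - \<rho>)) (x ` T)"
  unfolding realizable_def
proof (intro allI impI)
  fix \<sigma> :: "real \<Rightarrow> real" assume \<sigma>: "\<forall>x. \<sigma> x \<in> {-1, 1}"
  then obtain P where P: "P \<in> poly_class D C"
      and close: "\<And>i. i \<in> T \<Longrightarrow> cmod (poly P (of_real (x i)) - of_real (\<sigma> (x i))) \<le> \<rho>"
    using pat[of "\<lambda>i. \<sigma> (x i)"] by blast
  define p where "p = smult (1 / (1 - \<rho>)) (map_poly Re P)"
  have poly_p: "poly p t = Re (poly P (of_real t)) / (1 - \<rho>)" for t
    by (simp add: p_def poly_map_poly_Re)
  have "degree p \<le> degree P"
    unfolding p_def by (intro order_trans[OF degree_smult_le] degree_le) (simp add: coeff_map_poly coeff_eq_0)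
  moreover have "degree P \<le> nat \<lfloor>D\<rfloor>"
    using P D by (auto simp: poly_class_def le_nat_floor)
  moreover have "\<bar>poly p t\<bar> \<le> C / (1 - \<rho>)" if "t \<in> {-1..1}" for t
  proof -
    have "\<bar>Re (poly P (of_real t))\<bar> \<le> C"
      using order_trans[OF abs_Re_le_cmod cmod_poly_le_unit_norm[OF that]] P
      by (auto simp: poly_class_def intro: order_trans)
    then show ?thesis using \<rho> by (simp add: poly_p abs_divide divide_right_mono)
  qed
  moreover have "1 \<le> \<sigma> t * poly p t" if t: "t \<in> x ` T" for t
  proof -
    from t obtain i where i: "i \<in> T" "t = x i" by blast
    have "\<bar>Re (poly P (of_real t)) - \<sigma> t\<bar> \<le> \<rho>"
      using order_trans[OF abs_Re_le_cmod close[OF i(1)]] i(2) by simp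
    then have "1 - \<rho> \<le> \<sigma> t * Re (poly P (of_real t))"
      using \<sigma>[rule_format, of t] by auto
    then show ?thesis using \<rho> by (simp add: poly_p le_divide_eq)
  qed
  ultimately show "\<exists>p. degree p \<le> nat \<lfloor>D\<rfloor> \<and> (\<forall>x\<in>{-1..1}. \<bar>poly p x\<bar> \<le> C / (1 - \<rho>)) \<and>
      (\<forall>t\<in>x ` T. 1 \<le> \<sigma> t * poly p t)"
    by (intro exI[of _ p]) auto
qed

lemma zero_in_poly_class: "0 < C \<Longrightarrow> 0 \<in> poly_class D C"
  by (simp add: poly_class_def unit_norm_def)

text \<open>Either gluing forces more than \<open>\<epsilon> * n\<close> errors, or so many indices
  survive that \<open>ln_le_of_realizable\<close> applies to their nodes and contradicts
  \<open>big\<close>.\<close>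

lemma exists_hard_signs:
  fixes C \<rho> B :: real and n R W :: nat and x :: "nat \<Rightarrow> real"
  assumes C: "0 < C" and \<rho>: "\<rho> < 1" and R: "1 + C / (1 - \<rho>) \<le> real R"
    and big: "84 * (1 + C / (1 - \<rho>)) < ln (real R)"
    and B: "B = 100000 * real R ^ 4" and W: "real W = 12 * (real R)\<^sup>2 * B\<^sup>2"
    and \<epsilon>: "\<epsilon> = 1 / (2 * real R * (1 + 2 * real W))"
    and n: "R \<le> n" and x: "x \<in> {1..n} \<rightarrow> {-1..1}"
  shows "\<exists>y\<in>{1..n} \<rightarrow> {-1, 1}. \<forall>P\<in>poly_class ((1 + \<epsilon>) * real n) C.
    \<epsilon> * real n < real (error_count \<rho> n P x y)"
proof -
  let ?G = "poly_class ((1 + \<epsilon>) * real n) C"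
  define K where "K = C / (1 - \<rho>)"
  have K: "0 < K" using C \<rho> by (simp add: K_def)
  have R1: "1 < real R" using R K by (simp add: K_def)
  have Wpos: "0 < real W" using W B R1 by simp
  then have W1: "1 \<le> W" by simp
  have \<epsilon>0: "0 < \<epsilon>" using R1 Wpos by (simp add: \<epsilon>)
  have n0: "0 < n" using n R1 by linarith
  have "?G \<noteq> {}" using zero_in_poly_class[OF C] by blast
  from glue_sign_patterns[OF finite_atLeastAtMost[of 1 n] this, of "2 * W"
      "\<lambda>P i s. cmod (poly P (of_real (x i)) - of_real s) \<le> \<rho>"]
  obtain X f y where "X \<subseteq> {1..n} \<and> card {1..n} \<le> card X + 2 * W * f \<and> y \<in> {1..n} \<rightarrow> {-1, 1} \<and>
    (\<forall>P\<in>?G. f \<le> card {i \<in> {1..n}. \<not> cmod (poly P (of_real (x i)) - of_real (y i)) \<le> \<rho>}) \<and>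
    (\<forall>S\<subseteq>X. card S \<le> 2 * W \<longrightarrow> (\<forall>\<sigma>. (\<forall>i. \<sigma> i \<in> {-1, 1}) \<longrightarrow>
      (\<exists>P\<in>?G. \<forall>i\<in>S. cmod (poly P (of_real (x i)) - of_real (\<sigma> i)) \<le> \<rho>)))"
    by (elim exE) (rule that)
  then have X: "X \<subseteq> {1..n}" "card {1..n} \<le> card X + 2 * W * f"
    and y: "y \<in> {1..n} \<rightarrow> {-1, 1}"
      "\<And>P. P \<in> ?G \<Longrightarrow> f \<le> card {i \<in> {1..n}. \<not> cmod (poly P (of_real (x i)) - of_real (y i)) \<le> \<rho>}"
    and good: "\<And>S \<sigma>. S \<subseteq> X \<Longrightarrow> card S \<le> 2 * W \<Longrightarrow> (\<And>i. \<sigma> i \<in> {-1, 1}) \<Longrightarrow>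
      \<exists>P\<in>?G. \<forall>i\<in>S. cmod (poly P (of_real (x i)) - of_real (\<sigma> i)) \<le> \<rho>"
    by meson+
  show ?thesis
  proof (cases "\<epsilon> * real n < real f")
    case True
    have "\<epsilon> * real n < real (error_count \<rho> n P x y)" if "P \<in> ?G" for P
      using True y(2)[OF that] by (simp add: error_count_def not_le)
    then show ?thesis using y(1) by blast
  next
    case False
    \<comment> \<open>Surviving nodes are distinct: a repeated node cannot be within
      \<open>\<rho> < 1\<close> of both signs.\<close>
    have "inj_on x X"
    proof (rule inj_onI, rule ccontr)
      fix i j assume ij: "i \<in> X" "j \<in> X" "x i = x j" "i \<noteq> j"
      have "card {i, j} \<le> 2 * W" using ij(4) W1 by simp
      then have "\<exists>P\<in>?G. \<forall>k\<in>{i, j}. cmod (poly P (of_real (x k)) - of_real (if k = i then 1 else -1)) \<le> \<rho>"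
        using ij by (intro good) auto
      then obtain P where P: "\<And>k. k \<in> {i, j} \<Longrightarrow>
          cmod (poly P (of_real (x k)) - of_real (if k = i then 1 else -1)) \<le> \<rho>" by meson
      define z where "z = poly P (of_real (x j))"
      have "cmod (z - 1) \<le> \<rho>" "cmod (z + 1) \<le> \<rho>" using P[of i] P[of j] ij by (simp_all add: z_def)
      moreover have "2 \<le> cmod (z + 1) + cmod (z - 1)" using norm_triangle_ineq4[of "z + 1" "z - 1"] by simp
      ultimately show False using \<rho> by linarith
    qed
    define m where "m = nat \<lfloor>(1 + \<epsilon>) * real n\<rfloor>"
    define q where "q = n div R"
    have "\<epsilon> \<le> 1"
    proof -
      have "1 * 1 \<le> (2 * real R) * (1 + 2 * real W)" using R1 Wpos by (intro mult_mono) auto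
      then show ?thesis using R1 Wpos by (simp add: \<epsilon> divide_le_eq_1)
    qed
    have m: "real m \<le> (1 + \<epsilon>) * real n" "n \<le> m"
      unfolding m_def using \<epsilon>0 by (auto intro!: of_nat_floor le_nat_floor simp: mult_le_cancel_right1)
    have "(1 + \<epsilon>) * real n \<le> 2 * real n" using \<open>\<epsilon> \<le> 1\<close> by (intro mult_right_mono) auto
    then have m2: "m \<le> 2 * n" using m(1) by linarith
    have q: "1 \<le> q" "q * R \<le> n"
      using n R1 by (auto simp: q_def div_greater_zero_iff Suc_le_eq)
    have nq: "n \<le> 2 * (q * R)"
    proof -
      have "n < (q + 1) * R" unfolding q_def using R1
        by (metis Suc_eq_plus1 dividend_less_div_times gr_zeroI mult.commute mult_Suc_right not_one_less_zero of_nat_0)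
      also have "\<dots> \<le> (2 * q) * R" using q(1) by (intro mult_right_mono) auto
      finally show ?thesis by simp
    qed
    have inX: "x ` X \<subseteq> {-1..1}" using X(1) x by auto
    have finX: "finite X" using X(1) finite_subset by blast
    have cardX: "card (x ` X) = card X" using \<open>inj_on x X\<close> by (rule card_image)
    have "card X \<le> n" using card_mono[OF _ X(1)] by simp
    \<comment> \<open>This fixes \<open>\<epsilon>\<close>: the removed indices and the excess
      degree together are at most \<open>(1 + 2 * W) * \<epsilon> * n = n / (2 * R)\<close>, hence
      at most \<open>q\<close>. The remaining \<open>q + 1\<close> is at most
      \<open>2 * q\<close>.\<close>
    have "m + q + 1 \<le> card (x ` X) + 3 * q"
    proof -
      have "real n \<le> real (card X) + 2 * real W * real f"
        using X(2) by (metis card_atLeastAtMost diff_Suc_1 of_nat_add of_nat_le_iff of_nat_mult of_nat_numeral)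
      also have "\<dots> \<le> real (card X) + 2 * real W * (\<epsilon> * real n)"
        using False by (intro add_left_mono mult_left_mono) auto
      finally have "real m \<le> real (card X) + (1 + 2 * real W) * \<epsilon> * real n"
        using m(1) by (simp add: algebra_simps)
      also have "(1 + 2 * real W) * \<epsilon> * real n = real n / (2 * real R)"
        using Wpos by (simp add: \<epsilon> divide_simps)
      also have "\<dots> \<le> real q"
      proof -
        have "real n \<le> real (2 * (q * R))" using nq by (simp only: of_nat_le_iff)
        then show ?thesis using R1 by (simp add: divide_le_eq mult_ac)
      qed
      finally have "m \<le> card X + q" by linarith
      then show ?thesis using q(1) cardX by linarith
    qed
    have "ln (real R) \<le> 84 * (1 + K)"
    proof (rule ln_le_of_realizable[where X = "x ` X" and W = W and B = B and n = n and m = m and q = q])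
      fix S assume S: "S \<subseteq> x ` X" "card S \<le> 2 * W"
      then obtain T where T: "T \<subseteq> X" "inj_on x T" "S = x ` T" by (auto simp: subset_image_inj)
      then have "card T \<le> 2 * W" using S(2) by (simp add: card_image)
      then show "realizable m K S"
        unfolding T(3) m_def K_def using C \<rho> T(1) \<epsilon>0 by (intro realizable_of_poly_class good) auto
    qed (use finX inX n0 m m2 q nq K R B W cardX \<open>card X \<le> n\<close> \<open>m + q + 1 \<le> card (x ` X) + 3 * q\<close> in \<open>auto simp: K_def\<close>)
    then show ?thesis using big by (simp add: K_def)
  qed
qed

theorem theorem2p1:
  shows "\<exists>A::real. A > 0 \<and>
    (\<forall>C \<rho> :: real. C > 0 \<longrightarrow> 0 \<le> \<rho> \<longrightarrow> \<rho> < 1 \<longrightarrow>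
      (\<exists>(\<epsilon>::real) (n\<^sub>0::nat). 0 < \<epsilon> \<and> \<epsilon> < 1 \<and> 1 \<le> n\<^sub>0 \<and>
        \<epsilon> \<ge> exp (- (A * (1 + C / (1 - \<rho>)))) \<and>
        real n\<^sub>0 \<le> exp (A * (1 + C / (1 - \<rho>))) \<and>
        (\<forall>n::nat. n \<ge> n\<^sub>0 \<longrightarrow>
          (\<forall>x \<in> {1..n} \<rightarrow> {-1..1::real}. \<exists>y \<in> {1..n} \<rightarrow> {-1, 1::real}.
            \<forall>P \<in> poly_class ((1 + \<epsilon>) * real n) C.
              real (error_count \<rho> n P x y) > \<epsilon> * real n))))"
proof (rule exI[of _ "1000::real"], intro conjI allI impI)
  show "(0::real) < 1000" by simp
  fix C \<rho> :: real
  assume C: "C > 0" and \<rho>: "0 \<le> \<rho>" "\<rho> < 1"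
  define L where "L = 1 + C / (1 - \<rho>)"
  have L: "1 < L" using C \<rho> by (simp add: L_def)
  \<comment> \<open>The exponent 85 beats the factor 84 of the contradiction; rounding up costs at
    most one more \<open>L\<close>. The same \<open>R\<close> serves as
    \<open>n\<^sub>0\<close>.\<close>
  define R where "R = nat \<lceil>exp (85 * L)\<rceil>"
  define B where "B = 100000 * real R ^ 4"
  define W where "W = 12 * R\<^sup>2 * (100000 * R ^ 4)\<^sup>2"
  define \<epsilon> where "\<epsilon> = 1 / (2 * real R * (1 + 2 * real W))"
  have W: "real W = 12 * (real R)\<^sup>2 * B\<^sup>2" by (simp add: W_def B_def)
  have R: "exp (85 * L) \<le> real R" "real R \<le> exp (86 * L)"
  proof -
    show "exp (85 * L) \<le> real R" unfolding R_def by (rule real_nat_ceiling_ge)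
    have "real R \<le> exp (85 * L) + 1"
      unfolding R_def by (simp add: of_nat_nat)
    also have "\<dots> \<le> exp (85 * L) * 2" using L by simp
    also have "\<dots> \<le> exp (85 * L) * exp L"
    proof (rule mult_left_mono)
      show "2 \<le> exp L" using exp_ge_add_one_self[of L] L by linarith
    qed simp
    finally show "real R \<le> exp (86 * L)" by (simp add: exp_add[symmetric])
  qed
  have L_le: "L \<le> real R"
    using exp_ge_add_one_self[of "85 * L"] R(1) L by linarith
  have "84 * L < ln (real R)"
  proof -
    have "85 * L \<le> ln (real R)" using R(1) L_le L by (simp add: ln_ge_iff)
    then show ?thesis using L by linarith
  qed
  have R1: "1 < real R" using L L_le by linarith
  have "1 \<le> W" using R1 by (simp add: W_def)
  then have W1: "1 \<le> real W" by simp
  have \<epsilon>: "0 < \<epsilon>" "\<epsilon> < 1"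
  proof -
    show "0 < \<epsilon>" using R1 W1 by (simp add: \<epsilon>_def)
    have "1 * 1 < (2 * real R) * (1 + 2 * real W)" using R1 W1 by (intro mult_strict_mono) auto
    then show "\<epsilon> < 1" using R1 W1 by (simp add: \<epsilon>_def divide_less_eq_1)
  qed
  \<comment> \<open>The reciprocal of \<open>\<epsilon>\<close> is polynomial in \<open>R\<close>,
    of order \<open>R^11\<close>, and \<open>7.2 * 10^11 \<le> 2^40\<close>; with
    \<open>L > 1\<close> the exponent \<open>40 + 946 * L\<close> stays below
    \<open>1000 * L\<close>.\<close>
  have "2 * real R * (1 + 2 * real W) \<le> 2 * real R * (3 * real W)"
    using W1 by (intro mult_left_mono) auto
  also have "\<dots> = 720000000000 * real R ^ 11"
    by (simp add: W B_def power_mult_distrib power_mult[symmetric] power_add[symmetric] power2_eq_square[of "100000::real"]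
        eval_nat_numeral)
  also have "\<dots> \<le> 2 ^ 40 * exp (86 * L) ^ 11"
    using R(2) by (intro mult_mono power_mono) auto
  also have "\<dots> \<le> exp 1 ^ 40 * exp (86 * L) ^ 11"
    using exp_ge_add_one_self[of 1] by (intro mult_right_mono power_mono) auto
  also have "\<dots> = exp (40 + 946 * L)"
    by (simp add: exp_of_nat_mult[symmetric] exp_add[symmetric])
  also have "\<dots> \<le> exp (1000 * L)" using L by simp
  finally have "1 / exp (1000 * L) \<le> \<epsilon>"
    unfolding \<epsilon>_def using R1 W1 by (intro divide_left_mono) auto
  then have \<epsilon>_ge: "exp (- (1000 * L)) \<le> \<epsilon>" by (simp add: exp_minus inverse_eq_divide)
  have "real R \<le> exp (1000 * L)" using R(2) L by (intro order_trans[OF R(2)]) simp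
  then show "\<exists>(\<epsilon>::real) (n\<^sub>0::nat). 0 < \<epsilon> \<and> \<epsilon> < 1 \<and> 1 \<le> n\<^sub>0 \<and>
        \<epsilon> \<ge> exp (- (1000 * (1 + C / (1 - \<rho>)))) \<and>
        real n\<^sub>0 \<le> exp (1000 * (1 + C / (1 - \<rho>))) \<and>
        (\<forall>n::nat. n \<ge> n\<^sub>0 \<longrightarrow>
          (\<forall>x \<in> {1..n} \<rightarrow> {-1..1::real}. \<exists>y \<in> {1..n} \<rightarrow> {-1, 1::real}.
            \<forall>P \<in> poly_class ((1 + \<epsilon>) * real n) C.
              real (error_count \<rho> n P x y) > \<epsilon> * real n))"
    using \<epsilon> \<epsilon>_ge R1 exists_hard_signs[OF C \<rho>(2) _ _ B_def W \<epsilon>_def] L_le \<open>84 * L < ln (real R)\<close>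
    by (intro exI[of _ \<epsilon>] exI[of _ R]) (simp add: L_def)
qed

end
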